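(* Every $\mathsf{QCD}$ space is a measured-length space. That is: let $(X,d,m)$ be a geodesic Monge space satisfying the quasi curvature-dimension condition $\mathsf{QCD}(Q,K,N)$ for some $Q\ge 1$, $K\in\mathbb R$, $N\in(1,\infty)$. Then $(X,d,m)$ is a measured-length space.
   Context: A metric measure space $(X,d,m)$ is a complete separable metric space $(X,d)$ with an atomless Borel measure $m$ which is finite on bounded sets and has full topological support. It is geodesic if any two points are joined by a constant-speed geodesic. $\mathscr P(X)$ is the set of Borel probability measures on $X$; $\mathscr P_2(X)$ those with finite second moment, with the $L^2$-Wasserstein distance $W_2$; $\mathscr P^m_c(X)$ those that are compactly supported and absolutely continuous w.r.t. $m$. Let $I=[0,1]$, let $\mathrm{Geo}(X,d)$ be the set of constant-speed geodesics $\gamma:I\to X$, i.e. $d(\gamma_s,\gamma_t)=|s-t|\,d(\gamma_0,\gamma_1)$, with the supremum distance, and let $\mathrm{ev}_t(\gamma)=\gamma_t$. $\mathrm{OptGeo}(\mu_0,\mu_1)$ is the set of Borel probability measures $\pi$ on $\mathcal C(I;X)$ concentrated on $\mathrm{Geo}(X,d)$ with $(\mathrm{ev}_i)_\sharp\pi=\mu_i$, $i=0,1$, and $W_2(\mu_0,\mu_1)^2=\int\int_I|\dot\gamma|_t^2\,dt\,d\pi(\gamma)$, where $|\dot\gamma|_t$ is the metric speed (optimal dynamical plans). Monge space: for every $\mu_0,\mu_1\in\mathscr P_2(X)$ with $\mu_0\ll m$: (a) there is a unique $\pi\in\mathrm{OptGeo}(\mu_0,\mu_1)$; (b) $\pi=T_\sharp\mu_0$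 for some map $T:X\to\mathrm{Geo}(X,d)$; (c) $\mu_t:=(\mathrm{ev}_t)_\sharp\pi\ll m$ for all $t\in[0,1)$. Write $\rho_t=d\mu_t/dm$. Distortion coefficients: for $K\in\mathbb R$, $N\in(1,\infty)$, $t\in(0,1)$, $\theta\ge0$, put $\tau^{(t)}_{K,N}(\theta)=t^{1/N}\big(\sigma^{(t)}_{K,N-1}(\theta)\big)^{1-1/N}$, where, with $\kappa=K/(N-1)$, $\sigma^{(t)}_{K,N-1}(\theta)=\sin(t\theta\sqrt{\kappa})/\sin(\theta\sqrt{\kappa})$ if $K>0$ and $0<\theta<\pi/\sqrt\kappa$, $=+\infty$ if $K>0$ and $\theta\ge\pi/\sqrt\kappa$, $=t$ if $K=0$ or $\theta=0$, and $=\sinh(t\theta\sqrt{-\kappa})/\sinh(\theta\sqrt{-\kappa})$ if $K<0$ and $\theta>0$. A geodesic Monge space satisfies $\mathsf{QCD}(Q,K,N)$ if for every $\mu_0,\mu_1\in\mathscr P^m_c(X)$, with $\pi$ the unique element of $\mathrm{OptGeo}(\mu_0,\mu_1)$, $$\rho_t^{-1/N}(\gamma_t)\ge Q^{-1/N}\Big(\tau^{(1-t)}_{K,N}(d(\gamma_0,\gamma_1))\,\rho_0^{-1/N}(\gamma_0)+\tau^{(t)}_{K,N}(d(\gamma_0,\gamma_1))\,\rho_1^{-1/N}(\gamma_1)\Big)$$ for every $t\in(0,1)$ and $\pi$-a.e. $\gamma$. Test plan: a Borel probability measure $\pi$ on $\mathcal C(I;X)$ concentrated on the $2$-absolutely continuous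 curves, with $\int\int_I|\dot\gamma|_t^2\,dt\,d\pi(\gamma)<\infty$, and with $(\mathrm{ev}_t)_\sharp\pi\le C m$ for some constant $C>0$ independent of $t\in I$. Measured-length space: $(X,d,m)$ such that there is a set $\Omega\subset X$ with $m(X\setminus\Omega)=0$ such that for all $x_0,x_1\in\Omega$ there is $\varepsilon=\varepsilon(x_0,x_1)>0$ such that for all $\varepsilon_0,\varepsilon_1\in(0,\varepsilon]$ there is a test plan $\pi^{\varepsilon_0,\varepsilon_1}$ with: (a) $(0,\varepsilon]^2\ni(\varepsilon_0,\varepsilon_1)\mapsto\int\varphi\,d\pi^{\varepsilon_0,\varepsilon_1}$ is Borel for every bounded continuous $\varphi$ on $\mathcal C(I;X)$; (b) $(\mathrm{ev}_i)_\sharp\pi^{\varepsilon_0,\varepsilon_1}=\frac{1}{m(B_{\varepsilon_i}(x_i))}\mathbf 1_{B_{\varepsilon_i}(x_i)}\,m$ for $i=0,1$; (c) $\limsup_{\varepsilon_0,\varepsilon_1\downarrow0}\int\int_I|\dot\gamma|_t^2\,dt\,d\pi^{\varepsilon_0,\varepsilon_1}(\gamma)\le d(x_0,x_1)^2$. Here $B_r(x)$ is the open ball. *)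

theory Defs
  imports "HOL-Probability.Probability"
begin

section \<open>The space \<open>C([0,1]; X)\<close> with the supremum distance\<close>

text \<open>Curves are represented by functions on all of \<open>real\<close> that are fixed to \<open>undefined\<close> outside
  \<open>[0,1]\<close>, so that equality of curves is equality on \<open>[0,1]\<close>.\<close>

typedef (overloaded) 'a curve =
  "{\<gamma> :: real \<Rightarrow> 'a::metric_space. continuous_on {0..1} \<gamma> \<and> \<gamma> \<in> extensional {0..1}}"
  morphisms curve_at Curve
proof
  show "restrict (\<lambda>_. undefined) {0..1} \<in>
      {\<gamma> :: real \<Rightarrow> 'a. continuous_on {0..1} \<gamma> \<and> \<gamma> \<in> extensional {0..1}}"
    by (auto simp: extensional_def)
qed

definition ev :: "real \<Rightarrow> 'a::metric_space curve \<Rightarrow> 'a" where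
  "ev t \<gamma> = curve_at \<gamma> t"

lemma continuous_on_curve: "continuous_on {0..1} (\<lambda>t. ev t \<gamma>)"
  using curve_at[of \<gamma>] by (simp add: ev_def)

lemma curve_eqI:
  assumes "\<And>t. t \<in> {0..1} \<Longrightarrow> ev t \<gamma> = ev t \<eta>"
  shows "\<gamma> = \<eta>"
proof -
  have "curve_at \<gamma> = curve_at \<eta>"
    using curve_at[of \<gamma>] curve_at[of \<eta>] assms
    by (auto intro!: extensionalityI[of _ "{0..1}"] simp: ev_def)
  then show ?thesis
    by (simp add: curve_at_inject)
qed

instantiation curve :: (metric_space) metric_space
begin

definition dist_curve :: "'a curve \<Rightarrow> 'a curve \<Rightarrow> real" where
  "dist_curve \<gamma> \<eta> = (SUP t\<in>{0..1}. dist (ev t \<gamma>) (ev t \<eta>))"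

definition uniformity_curve :: "('a curve \<times> 'a curve) filter" where
  "uniformity_curve = (INF e\<in>{0<..}. principal {(x, y). dist x y < e})"

definition open_curve :: "'a curve set \<Rightarrow> bool" where
  "open_curve S = (\<forall>x\<in>S. \<forall>\<^sub>F (x', y) in uniformity. x' = x \<longrightarrow> y \<in> S)"

lemma dist_ev_le:
  fixes \<gamma> \<eta> :: "'a curve"
  assumes "t \<in> {0..1}"
  shows "dist (ev t \<gamma>) (ev t \<eta>) \<le> dist \<gamma> \<eta>"
proof -
  have "compact ((\<lambda>t. dist (ev t \<gamma>) (ev t \<eta>)) ` {0..1})"
    by (intro compact_continuous_image continuous_on_dist continuous_on_curve compact_Icc)
  then have "bdd_above ((\<lambda>t. dist (ev t \<gamma>) (ev t \<eta>)) ` {0..1})"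
    by (intro bounded_imp_bdd_above compact_imp_bounded)
  then show ?thesis
    unfolding dist_curve_def using assms by (intro cSUP_upper)
qed

lemma dist_curve_le:
  fixes \<gamma> \<eta> :: "'a curve"
  assumes "\<And>t. t \<in> {0..1} \<Longrightarrow> dist (ev t \<gamma>) (ev t \<eta>) \<le> b"
  shows "dist \<gamma> \<eta> \<le> b"
  unfolding dist_curve_def using assms by (intro cSUP_least) auto

instance
proof
  fix \<gamma> \<eta> \<zeta> :: "'a curve"
  show "dist \<gamma> \<eta> = 0 \<longleftrightarrow> \<gamma> = \<eta>"
  proof
    assume "dist \<gamma> \<eta> = 0"
    then show "\<gamma> = \<eta>"
      by (intro curve_eqI) (metis dist_ev_le dist_le_zero_iff)
  next
    assume "\<gamma> = \<eta>"
    then show "dist \<gamma> \<eta> = 0"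
      by (simp add: dist_curve_def)
  qed
  show "dist \<gamma> \<eta> \<le> dist \<gamma> \<zeta> + dist \<eta> \<zeta>"
  proof (rule dist_curve_le)
    fix t :: real assume "t \<in> {0..1}"
    then show "dist (ev t \<gamma>) (ev t \<eta>) \<le> dist \<gamma> \<zeta> + dist \<eta> \<zeta>"
      by (intro order_trans[OF dist_triangle2[of _ _ "ev t \<zeta>"]] add_mono dist_ev_le)
  qed
qed (simp_all add: uniformity_curve_def open_curve_def)

end

definition Geo :: "'a::metric_space curve set" where
  "Geo = {\<gamma>. \<forall>s\<in>{0..1}. \<forall>t\<in>{0..1}.
      dist (ev s \<gamma>) (ev t \<gamma>) = \<bar>s - t\<bar> * dist (ev 0 \<gamma>) (ev 1 \<gamma>)}"

definition AC2 :: "'a::metric_space curve set" where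
  "AC2 = {\<gamma>. \<exists>g :: real \<Rightarrow> real. g \<in> borel_measurable lborel \<and> (\<forall>r. 0 \<le> g r) \<and>
      (\<integral>\<^sup>+ r\<in>{0..1}. ennreal ((g r)\<^sup>2) \<partial>lborel) < \<infinity> \<and>
      (\<forall>s t. 0 \<le> s \<and> s \<le> t \<and> t \<le> 1 \<longrightarrow>
        ennreal (dist (ev s \<gamma>) (ev t \<gamma>)) \<le> (\<integral>\<^sup>+ r\<in>{s..t}. ennreal (g r) \<partial>lborel))}"

text \<open>The limit below exists for almost every \<open>t\<close> if the curve is absolutely continuous; elsewhere
  the value is unspecified. It is integrated only against plans concentrated on \<^const>\<open>AC2\<close> or
  \<^const>\<open>Geo\<close>.\<close>

definition metric_speed :: "'a::metric_space curve \<Rightarrow> real \<Rightarrow> real" where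
  "metric_speed \<gamma> t =
     Lim (at t within {0..1}) (\<lambda>s. dist (ev s \<gamma>) (ev t \<gamma>) / \<bar>s - t\<bar>)"

definition kinetic_energy :: "'a::metric_space curve measure \<Rightarrow> ennreal" where
  "kinetic_energy \<pi> =
     (\<integral>\<^sup>+ \<gamma>. (\<integral>\<^sup>+ t\<in>{0..1}. ennreal ((metric_speed \<gamma> t)\<^sup>2) \<partial>lborel) \<partial>\<pi>)"


section \<open>Metric measure spaces and probability measures\<close>

definition measure_support :: "'a::topological_space measure \<Rightarrow> 'a set" where
  "measure_support \<mu> = {x. \<forall>U. open U \<and> x \<in> U \<longrightarrow> 0 < emeasure \<mu> U}"

definition atomless :: "'a measure \<Rightarrow> bool" where
  "atomless \<mu> \<longleftrightarrow> (\<forall>A\<in>sets \<mu>. 0 < emeasure \<mu> A \<longrightarrow>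
     (\<exists>B\<in>sets \<mu>. B \<subseteq> A \<and> 0 < emeasure \<mu> B \<and> emeasure \<mu> B < emeasure \<mu> A))"

text \<open>The class \<^class>\<open>polish_space\<close> fixes a complete metric whose topology is second countable,
  i.e. a complete separable metric space.\<close>

definition metric_measure_space :: "'a::polish_space measure \<Rightarrow> bool" where
  "metric_measure_space m \<longleftrightarrow>
     sets m = sets borel \<and> atomless m \<and>
     (\<forall>B\<in>sets borel. bounded B \<longrightarrow> emeasure m B < \<infinity>) \<and>
     measure_support m = UNIV"

definition geodesic_space :: "'a::metric_space itself \<Rightarrow> bool" where
  "geodesic_space _ \<longleftrightarrow> (\<forall>x y :: 'a. \<exists>\<gamma>\<in>Geo. ev 0 \<gamma> = x \<and> ev 1 \<gamma> = y)"

definition Prob :: "'a::topological_space measure set" where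
  "Prob = {\<mu>. prob_space \<mu> \<and> sets \<mu> = sets borel}"

definition Prob2 :: "'a::metric_space measure set" where
  "Prob2 = {\<mu>\<in>Prob. \<exists>x. (\<integral>\<^sup>+ y. ennreal ((dist x y)\<^sup>2) \<partial>\<mu>) < \<infinity>}"

definition Prob_c_ac :: "'a::metric_space measure \<Rightarrow> 'a measure set" where
  "Prob_c_ac m = {\<mu>\<in>Prob. compact (measure_support \<mu>) \<and> absolutely_continuous m \<mu>}"

definition couplings ::
    "'a::topological_space measure \<Rightarrow> 'a measure \<Rightarrow> ('a \<times> 'a) measure set" where
  "couplings \<mu> \<nu> = {q\<in>Prob. distr q borel fst = \<mu> \<and> distr q borel snd = \<nu>}"

text \<open>Meaningful for arguments in \<^const>\<open>Prob2\<close>, where the infimum is finite.\<close>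

definition W2 :: "'a::metric_space measure \<Rightarrow> 'a measure \<Rightarrow> real" where
  "W2 \<mu> \<nu> = sqrt (enn2real
     (INF q\<in>couplings \<mu> \<nu>. \<integral>\<^sup>+ z. ennreal ((dist (fst z) (snd z))\<^sup>2) \<partial>q))"

definition OptGeo :: "'a::metric_space measure \<Rightarrow> 'a measure \<Rightarrow> 'a curve measure set" where
  "OptGeo \<mu>0 \<mu>1 = {\<pi>\<in>Prob. (AE \<gamma> in \<pi>. \<gamma> \<in> Geo) \<and>
     distr \<pi> borel (ev 0) = \<mu>0 \<and> distr \<pi> borel (ev 1) = \<mu>1 \<and>
     ennreal ((W2 \<mu>0 \<mu>1)\<^sup>2) = kinetic_energy \<pi>}"

definition Monge_space :: "'a::polish_space measure \<Rightarrow> bool" where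
  "Monge_space m \<longleftrightarrow> metric_measure_space m \<and>
     (\<forall>\<mu>0\<in>Prob2. \<forall>\<mu>1\<in>Prob2. absolutely_continuous m \<mu>0 \<longrightarrow>
        (\<exists>!\<pi>. \<pi> \<in> OptGeo \<mu>0 \<mu>1) \<and>
        (\<forall>\<pi>\<in>OptGeo \<mu>0 \<mu>1.
           (\<exists>T. T \<in> borel \<rightarrow>\<^sub>M borel \<and> range T \<subseteq> Geo \<and> \<pi> = distr \<mu>0 borel T) \<and>
           (\<forall>t\<in>{0..<1}. absolutely_continuous m (distr \<pi> borel (ev t)))))"


section \<open>The quasi curvature-dimension condition\<close>

text \<open>The second argument is the dimension parameter of \<open>\<sigma>\<close> itself, i.e. \<open>N - 1\<close> in \<open>\<tau>\<close>.\<close>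

definition sigma_coeff :: "real \<Rightarrow> real \<Rightarrow> real \<Rightarrow> real \<Rightarrow> ennreal" where
  "sigma_coeff K n t \<theta> = (let \<kappa> = K / n in
     if K = 0 \<or> \<theta> = 0 then ennreal t
     else if K > 0 then
       (if \<theta> < pi / sqrt \<kappa> then ennreal (sin (t * \<theta> * sqrt \<kappa>) / sin (\<theta> * sqrt \<kappa>)) else \<infinity>)
     else ennreal (sinh (t * \<theta> * sqrt (- \<kappa>)) / sinh (\<theta> * sqrt (- \<kappa>))))"

text \<open>Power with a positive real exponent.\<close>

definition ennreal_rpow :: "ennreal \<Rightarrow> real \<Rightarrow> ennreal" where
  "ennreal_rpow x p = (if x = \<infinity> then \<infinity> else ennreal (enn2real x powr p))"

definition tau_coeff :: "real \<Rightarrow> real \<Rightarrow> real \<Rightarrow> real \<Rightarrow> ennreal" where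
  "tau_coeff K N t \<theta> =
     ennreal (t powr (1 / N)) * ennreal_rpow (sigma_coeff K (N - 1) t \<theta>) (1 - 1 / N)"

text \<open>\<open>dens m \<mu>\<close> is the density \<open>d\<mu>/dm\<close> as a real-valued function (it is finite \<open>m\<close>-a.e.).
  Along \<open>\<pi>\<close>-a.e. curve the densities below are positive, so the negative powers are genuine.\<close>

definition dens :: "'a measure \<Rightarrow> 'a measure \<Rightarrow> 'a \<Rightarrow> real" where
  "dens m \<mu> x = enn2real (RN_deriv m \<mu> x)"

definition QCD :: "real \<Rightarrow> real \<Rightarrow> real \<Rightarrow> 'a::polish_space measure \<Rightarrow> bool" where
  "QCD Q K N m \<longleftrightarrow>
     (\<forall>\<mu>0\<in>Prob_c_ac m. \<forall>\<mu>1\<in>Prob_c_ac m. \<forall>\<pi>\<in>OptGeo \<mu>0 \<mu>1. \<forall>t\<in>{0<..<1}.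
        AE \<gamma> in \<pi>.
          ennreal (dens m (distr \<pi> borel (ev t)) (ev t \<gamma>) powr (- 1 / N)) \<ge>
          ennreal (Q powr (- 1 / N)) *
            (tau_coeff K N (1 - t) (dist (ev 0 \<gamma>) (ev 1 \<gamma>)) *
               ennreal (dens m \<mu>0 (ev 0 \<gamma>) powr (- 1 / N)) +
             tau_coeff K N t (dist (ev 0 \<gamma>) (ev 1 \<gamma>)) *
               ennreal (dens m \<mu>1 (ev 1 \<gamma>) powr (- 1 / N))))"


section \<open>Measured-length spaces\<close>

definition test_plan :: "'a::metric_space measure \<Rightarrow> 'a curve measure \<Rightarrow> bool" where
  "test_plan m \<pi> \<longleftrightarrow> \<pi> \<in> Prob \<and> (AE \<gamma> in \<pi>. \<gamma> \<in> AC2) \<and> kinetic_energy \<pi> < \<infinity> \<and>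
     (\<exists>C::real. C > 0 \<and> (\<forall>t\<in>{0..1}. \<forall>A\<in>sets borel.
        emeasure (distr \<pi> borel (ev t)) A \<le> ennreal C * emeasure m A))"

definition measured_length_space :: "'a::polish_space measure \<Rightarrow> bool" where
  "measured_length_space m \<longleftrightarrow> metric_measure_space m \<and>
     (\<exists>\<Omega>. - \<Omega> \<in> null_sets m \<and>
       (\<forall>x0\<in>\<Omega>. \<forall>x1\<in>\<Omega>. \<exists>\<epsilon>>0. \<exists>\<pi> :: real \<Rightarrow> real \<Rightarrow> 'a curve measure.
          (\<forall>\<epsilon>0\<in>{0<..\<epsilon>}. \<forall>\<epsilon>1\<in>{0<..\<epsilon>}.
             test_plan m (\<pi> \<epsilon>0 \<epsilon>1) \<and>
             distr (\<pi> \<epsilon>0 \<epsilon>1) borel (ev 0) = uniform_measure m (ball x0 \<epsilon>0) \<and>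
             distr (\<pi> \<epsilon>0 \<epsilon>1) borel (ev 1) = uniform_measure m (ball x1 \<epsilon>1)) \<and>
          (\<forall>\<phi> :: 'a curve \<Rightarrow> real. continuous_on UNIV \<phi> \<and> bounded (range \<phi>) \<longrightarrow>
             (\<lambda>(\<epsilon>0, \<epsilon>1). \<integral>\<gamma>. \<phi> \<gamma> \<partial>\<pi> \<epsilon>0 \<epsilon>1)
               \<in> borel_measurable (restrict_space borel ({0<..\<epsilon>} \<times> {0<..\<epsilon>}))) \<and>
          Limsup (at_right 0 \<times>\<^sub>F at_right 0) (\<lambda>(\<epsilon>0, \<epsilon>1). kinetic_energy (\<pi> \<epsilon>0 \<epsilon>1))
            \<le> ennreal ((dist x0 x1)\<^sup>2)))"

end

theory Submission
  imports Defs
begin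

text \<open>The plans are taken from the independent coupling instead of an optimal one. If \<open>G (x, y)\<close> is a
  Borel selection of geodesics from \<open>x\<close> to \<open>y\<close>, the image under \<open>G\<close> of the product of the uniform
  measures on the two balls depends measurably on the radii by Fubini's theorem, and its energy is
  at most \<open>(d(x\<^sub>0, x\<^sub>1) + \<epsilon>\<^sub>0 + \<epsilon>\<^sub>1)\<^sup>2\<close>. The bounded compression comes from the curvature-dimension
  condition applied to transport towards a single point: with \<open>y\<close> fixed, moving an absolutely
  continuous measure half-way towards \<open>y\<close> keeps its density bounded. The condition is only given for
  absolutely continuous targets, so \<open>y\<close> is replaced by shrinking balls; the limit is controlled
  because closed balls are compact and because, by uniqueness of optimal plans to a Dirac mass,
  almost every \<open>x\<close> has a unique geodesic to \<open>y\<close>. Compactness of balls follows from a uniform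
  lower bound for the measure of small balls, again by the curvature-dimension condition.\<close>

section \<open>Lower bounds for the distortion coefficients\<close>

text \<open>For optimal plans between the two balls, Borel dependence on the radii would need a
  separate argument. The product coupling depends on the radii explicitly, but it is in general not
  optimal, so the density inequality does not apply to it directly. Disintegrating it over one
  endpoint repairs this: what remains is transport to a Dirac mass, for which every coupling is
  optimal. A test plan needs a compression constant uniform in time only, so it may depend on the
  radii, and all curvature effects can go into one crude factor, a \<open>cosh\<close> of the
  largest distance involved. The factor \<open>1 - t\<close> kept from the inequality vanishes at
  the target, so a frozen endpoint controls only the half of the time interval farther from it, and
  both endpoints have to take their turn.\<close>

lemma sin_scale_ge:
  fixes t x :: real
  assumes "0 \<le> t" "t \<le> 1" "0 \<le> x" "x \<le> pi"
  shows "t * sin x \<le> sin (t * x)"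
proof -
  have "concave_on {0..pi} sin"
    by (rule f''_le0_imp_concave[where f' = cos and f'' = "\<lambda>x. - sin x"])
      (auto intro!: derivative_eq_intros sin_ge_zero)
  then have "sin ((1 - t) *\<^sub>R 0 + t *\<^sub>R x) \<ge> (1 - t) * sin 0 + t * sin x"
    using assms by (intro concave_onD) auto
  then show ?thesis by simp
qed

lemma sinh_le_mult_cosh:
  fixes x :: real
  assumes "0 \<le> x"
  shows "sinh x \<le> x * cosh x"
proof -
  have "(\<lambda>x::real. x * cosh x - sinh x) 0 \<le> (\<lambda>x::real. x * cosh x - sinh x) x"
  proof (rule DERIV_nonneg_imp_nondecreasing[OF assms])
    fix y :: real assume "0 \<le> y" "y \<le> x"
    then show "\<exists>d. ((\<lambda>x::real. x * cosh x - sinh x) has_real_derivative d) (at y) \<and> 0 \<le> d"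
      by (intro exI[of _ "y * sinh y"] conjI) (auto intro!: derivative_eq_intros simp: cosh_real_ge_1)
  qed
  then show ?thesis by simp
qed

lemma le_sinh:
  fixes x :: real
  assumes "0 \<le> x"
  shows "x \<le> sinh x"
proof -
  have "(\<lambda>x::real. sinh x - x) 0 \<le> (\<lambda>x::real. sinh x - x) x"
  proof (rule DERIV_nonneg_imp_nondecreasing[OF assms])
    fix y :: real assume "0 \<le> y" "y \<le> x"
    then show "\<exists>d. ((\<lambda>x::real. sinh x - x) has_real_derivative d) (at y) \<and> 0 \<le> d"
      by (intro exI[of _ "cosh y - 1"] conjI) (auto intro!: derivative_eq_intros simp: cosh_real_ge_1)
  qed
  then show ?thesis by simp
qed

text \<open>The price of negative curvature at distances up to \<open>D\<close>:
  \<open>sinh (t * x) / sinh x\<close> is at least \<open>t / cosh x\<close>, since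
  \<open>y \<le> sinh y \<le> y * cosh y\<close>. For \<open>K \<ge> 0\<close> the coefficient is at
  least \<open>t\<close>, by concavity of the sine if \<open>K > 0\<close>, so one constant with the
  absolute value of \<open>K\<close> covers all signs.\<close>

definition distortion_const :: "real \<Rightarrow> real \<Rightarrow> real \<Rightarrow> real" where
  "distortion_const K N D = cosh (D * sqrt (\<bar>K\<bar> / (N - 1)))"

lemma distortion_const_ge_1: "1 \<le> distortion_const K N D"
  by (simp add: distortion_const_def cosh_real_ge_1)

lemma sigma_coeff_ge:
  assumes t: "0 < t" "t < 1" and \<theta>: "0 \<le> \<theta>" "\<theta> \<le> D" and N: "1 < N"
  shows "ennreal (t / distortion_const K N D) \<le> sigma_coeff K (N - 1) t \<theta>"
proof -
  let ?c = "distortion_const K N D"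
  have c: "1 \<le> ?c" by (rule distortion_const_ge_1)
  have tc: "t / ?c \<le> t" using c t by (simp add: divide_simps)
  consider "K = 0 \<or> \<theta> = 0" | "\<theta> > 0" "K > 0" | "\<theta> > 0" "K < 0" using \<theta> by linarith
  then show ?thesis
  proof cases
    case 1
    then show ?thesis using tc by (auto simp: sigma_coeff_def Let_def intro!: ennreal_leI)
  next
    case 2
    let ?s = "sqrt (K / (N - 1))"
    have s: "0 < ?s" using 2 N by simp
    have "t \<le> sin (t * \<theta> * ?s) / sin (\<theta> * ?s)" if "\<theta> < pi / ?s"
    proof -
      have "\<theta> * ?s < pi" using that s by (metis pos_less_divide_eq)
      moreover have "0 < \<theta> * ?s" using 2 s by simp
      ultimately have "0 < sin (\<theta> * ?s)" "t * sin (\<theta> * ?s) \<le> sin (t * (\<theta> * ?s))"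
        using t by (auto intro!: sin_gt_zero sin_scale_ge)
      then show ?thesis by (simp add: pos_le_divide_eq mult.assoc)
    qed
    then show ?thesis using 2 tc
      by (auto simp: sigma_coeff_def Let_def intro!: ennreal_leI intro: order_trans)
  next
    case 3
    let ?x = "\<theta> * sqrt (- (K / (N - 1)))"
    have K: "\<bar>K\<bar> / (N - 1) = - (K / (N - 1))" using 3 by simp
    have "0 < - (K / (N - 1))" using 3 N by (simp add: field_simps)
    then have x: "0 < ?x" using 3 by simp
    have cx: "cosh ?x \<le> ?c"
      unfolding distortion_const_def K using \<theta> x \<open>0 < - (K / (N - 1))\<close>
      by (subst cosh_real_nonneg_le_iff)
        (auto intro!: mult_right_mono)
    have "t / ?c * sinh ?x \<le> t / ?c * (?x * cosh ?x)"
      using x t c by (intro mult_left_mono sinh_le_mult_cosh) auto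
    also have "\<dots> = t * ?x * (cosh ?x / ?c)" by simp
    also have "\<dots> \<le> t * ?x * 1"
      using x t c cx by (intro mult_left_mono) (auto simp: divide_simps)
    also have "\<dots> \<le> sinh (t * ?x)" using le_sinh[of "t * ?x"] x t by simp
    finally have "t / ?c \<le> sinh (t * ?x) / sinh ?x"
      using x by (simp add: pos_le_divide_eq)
    then show ?thesis using 3
      by (auto simp: sigma_coeff_def Let_def mult.assoc intro!: ennreal_leI)
  qed
qed

lemma ennreal_rpow_mono:
  assumes "ennreal x \<le> y" "0 \<le> x" "0 \<le> p"
  shows "ennreal (x powr p) \<le> ennreal_rpow y p"
proof (cases "y = \<infinity>")
  case False
  then obtain r where r: "0 \<le> r" "y = ennreal r" by (cases y) auto
  then have "x \<le> r" using assms by (simp add: ennreal_le_iff)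
  then show ?thesis using r assms
    by (auto simp: ennreal_rpow_def intro!: ennreal_leI powr_mono2)
qed (simp add: ennreal_rpow_def)

text \<open>The exponents \<open>1 / N\<close> and \<open>1 - 1 / N\<close> add up to one, so the
  linear bound for \<open>\<sigma>\<close> passes to \<open>\<tau>\<close> unchanged; the first
  factor lacks a power of the constant, which is harmless because the constant is at least
  1.\<close>

lemma tau_coeff_ge:
  assumes t: "0 < t" "t < 1" and \<theta>: "0 \<le> \<theta>" "\<theta> \<le> D" and N: "1 < N"
  shows "ennreal (t / distortion_const K N D) \<le> tau_coeff K N t \<theta>"
proof -
  let ?c = "distortion_const K N D"
  have c: "1 \<le> ?c" by (rule distortion_const_ge_1)
  have "t / ?c = (t / ?c) powr (1 / N) * (t / ?c) powr (1 - 1 / N)"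
    using t c by (simp add: powr_add[symmetric])
  also have "\<dots> \<le> t powr (1 / N) * (t / ?c) powr (1 - 1 / N)"
    using t c N by (intro mult_right_mono powr_mono2) (auto simp: divide_simps)
  finally have "ennreal (t / ?c) \<le> ennreal (t powr (1 / N)) * ennreal ((t / ?c) powr (1 - 1 / N))"
    by (simp add: ennreal_mult'[symmetric] ennreal_leI)
  also have "\<dots> \<le> tau_coeff K N t \<theta>"
    unfolding tau_coeff_def using t c N
    by (intro mult_left_mono ennreal_rpow_mono sigma_coeff_ge assms) auto
  finally show ?thesis .
qed

section \<open>Geodesics\<close>

lemma continuous_on_ev [continuous_intros]:
  assumes "t \<in> {0..1}"
  shows "continuous_on A (ev t)"
  unfolding continuous_on_iff
  by (meson assms dist_ev_le le_less_trans)

lemma measurable_ev [measurable (raw)]: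
  fixes f :: "'b \<Rightarrow> 'a::metric_space curve"
  assumes "t \<in> {0..1}" "f \<in> borel_measurable M"
  shows "(\<lambda>x. ev t (f x)) \<in> borel_measurable M"
  using borel_measurable_continuous_on[OF continuous_on_ev[OF assms(1)] assms(2)] .

lemma measurable_ev' [measurable]:
  assumes "t \<in> {0..1}"
  shows "ev t \<in> borel \<rightarrow>\<^sub>M borel"
  by (intro borel_measurable_continuous_onI continuous_on_ev assms)

lemma ev_Curve:
  assumes "continuous_on {0..1} f" "t \<in> {0..1}"
  shows "ev t (Curve (restrict f {0..1})) = f t"
proof -
  have "restrict f {0..1} \<in> {\<gamma>. continuous_on {0..1} \<gamma> \<and> \<gamma> \<in> extensional {0..1}}"
    using assms(1) continuous_on_cong[of "{0..1}" "{0..1}" "restrict f {0..1}" f] by simp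
  then show ?thesis
    using assms(2) by (simp add: ev_def Curve_inverse)
qed

lemma GeoD:
  assumes "\<gamma> \<in> Geo" "s \<in> {0..1}" "t \<in> {0..1}"
  shows "dist (ev s \<gamma>) (ev t \<gamma>) = \<bar>s - t\<bar> * dist (ev 0 \<gamma>) (ev 1 \<gamma>)"
  using assms unfolding Geo_def by blast

text \<open>The geodesic identity makes \<open>f\<close> Lipschitz, which supplies the continuity
  that the curve type demands. Used for reversed geodesics and for pointwise limits.\<close>

lemma Geo_exists_curve:
  fixes f :: "real \<Rightarrow> 'a::metric_space"
  assumes f: "\<And>s t. s \<in> {0..1} \<Longrightarrow> t \<in> {0..1} \<Longrightarrow> dist (f s) (f t) = \<bar>s - t\<bar> * dist (f 0) (f 1)"
  shows "\<exists>\<gamma>\<in>Geo. \<forall>t\<in>{0..1}. ev t \<gamma> = f t"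
proof -
  have "(dist (f 0) (f 1))-lipschitz_on {0..1} f"
  proof (rule lipschitz_onI)
    fix s t :: real assume "s \<in> {0..1}" "t \<in> {0..1}"
    from f[OF this] show "dist (f s) (f t) \<le> dist (f 0) (f 1) * dist s t"
      by (simp only: dist_real_def mult.commute)
  qed simp
  then have "continuous_on {0..1} f" by (rule lipschitz_on_continuous_on)
  note e = ev_Curve[OF this]
  have "Curve (restrict f {0..1}) \<in> Geo"
    unfolding Geo_def
  proof (intro CollectI ballI)
    fix s t :: real assume st: "s \<in> {0..1}" "t \<in> {0..1}"
    show "dist (ev s (Curve (restrict f {0..1}))) (ev t (Curve (restrict f {0..1}))) =
        \<bar>s - t\<bar> * dist (ev 0 (Curve (restrict f {0..1}))) (ev 1 (Curve (restrict f {0..1})))"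
      using f[OF st] e[OF st(1)] e[OF st(2)] e[of 0] e[of 1] by simp
  qed
  then show ?thesis
    using e by blast
qed

lemma Geo_reverse:
  fixes \<gamma> :: "'a::metric_space curve"
  assumes "\<gamma> \<in> Geo"
  shows "\<exists>\<eta>\<in>Geo. \<forall>t\<in>{0..1}. ev t \<eta> = ev (1 - t) \<gamma>"
proof (rule Geo_exists_curve)
  fix s t :: real assume "s \<in> {0..1}" "t \<in> {0..1}"
  then show "dist (ev (1 - s) \<gamma>) (ev (1 - t) \<gamma>) = \<bar>s - t\<bar> * dist (ev (1 - 0) \<gamma>) (ev (1 - 1) \<gamma>)"
    using GeoD[OF assms, of "1 - s" "1 - t"] by (simp add: dist_commute abs_minus_commute)
qed

lemma closed_Geo: "closed (Geo :: 'a::metric_space curve set)"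
proof -
  have "Geo = (\<Inter>s\<in>{0..1}. \<Inter>t\<in>{0..1}.
      {\<gamma> :: 'a curve. dist (ev s \<gamma>) (ev t \<gamma>) = \<bar>s - t\<bar> * dist (ev 0 \<gamma>) (ev 1 \<gamma>)})"
    unfolding Geo_def by blast
  also have "closed \<dots>"
    by (intro closed_INT ballI closed_Collect_eq continuous_intros) auto
  finally show ?thesis .
qed

lemma metric_speed_Geo:
  assumes "\<gamma> \<in> Geo" "t \<in> {0..1}"
  shows "metric_speed \<gamma> t = dist (ev 0 \<gamma>) (ev 1 \<gamma>)"
proof -
  \<comment> \<open>\<open>Lim\<close> has a determined value only along a nontrivial
    filter.\<close>
  have "t islimpt {0..1}"
    using assms(2) by (intro connected_imp_perfect) auto
  then have ne: "at t within {0..1::real} \<noteq> bot"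
    by (simp add: trivial_limit_within)
  have "\<forall>\<^sub>F s in at t within {0..1}. dist (ev s \<gamma>) (ev t \<gamma>) / \<bar>s - t\<bar> = dist (ev 0 \<gamma>) (ev 1 \<gamma>)"
    unfolding eventually_at using GeoD[OF assms(1) _ assms(2)]
    by (intro exI[of _ 1]) auto
  then have "((\<lambda>s. dist (ev s \<gamma>) (ev t \<gamma>) / \<bar>s - t\<bar>) \<longlongrightarrow> dist (ev 0 \<gamma>) (ev 1 \<gamma>)) (at t within {0..1})"
    by (rule tendsto_eventually)
  then show ?thesis
    unfolding metric_speed_def by (intro tendsto_Lim ne)
qed

text \<open>Turns the energy into a transport cost of the two endpoints, so that it can be compared
  with \<open>W2\<close> and estimated from the marginals.\<close>

lemma kinetic_energy_Geo:
  assumes "AE \<gamma> in \<pi>. \<gamma> \<in> Geo"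
  shows "kinetic_energy \<pi> = (\<integral>\<^sup>+ \<gamma>. ennreal ((dist (ev 0 \<gamma>) (ev 1 \<gamma>))\<^sup>2) \<partial>\<pi>)"
  unfolding kinetic_energy_def
proof (rule nn_integral_cong_AE, use assms in eventually_elim)
  fix \<gamma> :: "'a curve" assume "\<gamma> \<in> Geo"
  then have "ennreal ((metric_speed \<gamma> t)\<^sup>2) * indicator {0..1} t =
      ennreal ((dist (ev 0 \<gamma>) (ev 1 \<gamma>))\<^sup>2) * indicator {0..1} t" for t
    by (simp add: metric_speed_Geo indicator_def)
  then show "(\<integral>\<^sup>+ t\<in>{0..1}. ennreal ((metric_speed \<gamma> t)\<^sup>2) \<partial>lborel) =
      ennreal ((dist (ev 0 \<gamma>) (ev 1 \<gamma>))\<^sup>2)"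
    by (simp add: nn_integral_cmult_indicator)
qed

lemma Geo_subset_AC2: "Geo \<subseteq> AC2"
proof
  fix \<gamma> :: "'a curve" assume g: "\<gamma> \<in> Geo"
  let ?L = "dist (ev 0 \<gamma>) (ev 1 \<gamma>)"
  show "\<gamma> \<in> AC2"
    unfolding AC2_def
  proof (intro CollectI exI[of _ "\<lambda>_. ?L"] conjI allI impI)
    fix s t :: real assume "0 \<le> s \<and> s \<le> t \<and> t \<le> 1"
    then show "ennreal (dist (ev s \<gamma>) (ev t \<gamma>)) \<le> (\<integral>\<^sup>+ r\<in>{s..t}. ennreal ?L \<partial>lborel)"
      using GeoD[OF g, of s t]
      by (subst nn_integral_cmult_indicator) (simp_all add: ennreal_mult'[symmetric] mult.commute)
  qed (auto simp: nn_integral_cmult_indicator)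
qed

section \<open>A selection theorem for compact-valued maps\<close>

text \<open>Kuratowski--Ryll-Nardzewski: at stage \<open>n\<close> the value at \<open>x\<close> is confined to the first ball of radius
  \<open>2\<^sup>-\<^sup>n\<close> around a point of the dense sequence that still meets the remaining part of \<open>\<Gamma> x\<close>. The
  choices made so far take countably many values, and compactness keeps the intersection nonempty.\<close>

lemma compact_valued_measurable_selection:
  fixes \<Gamma> :: "'b \<Rightarrow> 'c::metric_space set" and c :: "nat \<Rightarrow> 'c"
  assumes compact: "\<And>x. x \<in> space M \<Longrightarrow> compact (\<Gamma> x)"
    and nonempty: "\<And>x. x \<in> space M \<Longrightarrow> \<Gamma> x \<noteq> {}"
    and hit: "\<And>F. closed F \<Longrightarrow> {x \<in> space M. \<Gamma> x \<inter> F \<noteq> {}} \<in> sets M"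
    and dense: "\<And>x \<gamma> e. x \<in> space M \<Longrightarrow> \<gamma> \<in> \<Gamma> x \<Longrightarrow> 0 < e \<Longrightarrow> \<exists>k. dist (c k) \<gamma> < e"
  shows "\<exists>S\<in>borel_measurable M. \<forall>x\<in>space M. S x \<in> \<Gamma> x"
proof -
  \<comment> \<open>The newest index stands in front, so the radius for \<open>k # l\<close> is read
    off from the length of the older choices \<open>l\<close>.\<close>
  define F where "F = rec_list UNIV (\<lambda>k l B. cball (c k) ((1/2) ^ length l) \<inter> B)"
  have F: "F [] = UNIV" "F (k # l) = cball (c k) ((1/2) ^ length l) \<inter> F l" for k l
    by (simp_all add: F_def)
  have closedF: "closed (F l)" for l
    by (induction l) (auto simp: F)
  define next_idx where "next_idx l x = (LEAST k. \<Gamma> x \<inter> F (k # l) \<noteq> {})" for l x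
  define h where "h = rec_nat (\<lambda>_. []) (\<lambda>n f x. next_idx (f x) x # f x)"
  have h: "h 0 x = []" "h (Suc n) x = next_idx (h n x) x # h n x" for n x
    by (simp_all add: h_def)
  have len: "length (h n x) = n" for n x
    by (induction n) (auto simp: h)
  have ne: "\<Gamma> x \<inter> F (h n x) \<noteq> {}" if x: "x \<in> space M" for n x
  proof (induction n)
    case 0
    then show ?case using nonempty[OF x] by (simp add: h F)
  next
    case (Suc n)
    then obtain \<gamma> where g: "\<gamma> \<in> \<Gamma> x" "\<gamma> \<in> F (h n x)" by auto
    obtain k where "dist (c k) \<gamma> < (1/2) ^ n"
      using dense[OF x g(1), of "(1/2) ^ n"] by auto
    then have "\<Gamma> x \<inter> F (k # h n x) \<noteq> {}"
      using g by (auto simp: F len)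
    then show ?case
      unfolding h next_idx_def by (rule LeastI)
  qed
  have meas: "h n \<in> M \<rightarrow>\<^sub>M count_space UNIV" for n
  proof (induction n)
    case (Suc n)
    have "(\<lambda>x. next_idx l x) \<in> M \<rightarrow>\<^sub>M count_space UNIV" for l
      unfolding next_idx_def using hit[OF closedF]
      by (intro measurable_Least) (simp add: pred_def)
    then have "(\<lambda>x. next_idx l x # l) \<in> M \<rightarrow>\<^sub>M count_space UNIV" for l
      by simp
    from measurable_compose_countable[OF this Suc] show ?case
      by (simp add: h[abs_def])
  qed (simp add: h[abs_def])
  have "\<exists>s. s \<in> \<Gamma> x \<and> (\<forall>n. s \<in> F (h n x))" if x: "x \<in> space M" for x
  proof -
    have anti: "F (h n x) \<subseteq> F (h m x)" if "m \<le> n" for m n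
      using that by (induction n rule: dec_induct) (auto simp: h F)
    have "\<Gamma> x \<inter> (\<Inter>n. F (h n x)) \<noteq> {}"
    proof (rule compact_imp_fip_image[OF compact[OF x]])
      fix I :: "nat set" assume "finite I" "I \<subseteq> UNIV"
      then obtain N where "\<forall>i\<in>I. i \<le> N" by (meson finite_nat_set_iff_bounded_le)
      then have "F (h N x) \<subseteq> (\<Inter>i\<in>I. F (h i x))" using anti by blast
      then show "\<Gamma> x \<inter> (\<Inter>i\<in>I. F (h i x)) \<noteq> {}" using ne[OF x, of N] by blast
    qed (simp add: closedF)
    then show ?thesis by auto
  qed
  then obtain S where S: "\<And>x. x \<in> space M \<Longrightarrow> S x \<in> \<Gamma> x"
      "\<And>x n. x \<in> space M \<Longrightarrow> S x \<in> F (h n x)"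
    by metis
  \<comment> \<open>\<open>S\<close> was chosen pointwise without regard to measurability. But the
    centre picked at stage \<open>n\<close>, the head of \<open>h (Suc n) x\<close>, is within
    \<open>(1/2) ^ n\<close> of \<open>S x\<close>, so \<open>S\<close> is a limit of measurable
    functions.\<close>
  have lim: "(\<lambda>n. c (hd (h (Suc n) x))) \<longlonglongrightarrow> S x" if x: "x \<in> space M" for x
  proof (rule metric_tendsto_imp_tendsto)
    show "(\<lambda>n. (1/2::real) ^ n) \<longlonglongrightarrow> 0"
      by (rule LIMSEQ_realpow_zero) auto
    show "\<forall>\<^sub>F n in sequentially. dist (c (hd (h (Suc n) x))) (S x) \<le> dist ((1/2::real) ^ n) 0"
      using S(2)[OF x, of "Suc _"] by (intro always_eventually allI) (simp add: h F len)
  qed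
  have "S \<in> borel_measurable M"
  proof (rule borel_measurable_LIMSEQ_metric[OF _ lim])
    fix n
    have "(\<lambda>l. c (hd l)) \<in> count_space UNIV \<rightarrow>\<^sub>M borel" by simp
    from measurable_compose[OF meas this] show "(\<lambda>x. c (hd (h (Suc n) x))) \<in> borel_measurable M" .
  qed
  then show ?thesis using S(1) by blast
qed

section \<open>Compactness of sets of geodesics\<close>

definition geo_between :: "'a set \<Rightarrow> 'a set \<Rightarrow> 'a::metric_space curve set" where
  "geo_between A B = {\<gamma>\<in>Geo. ev 0 \<gamma> \<in> A \<and> ev 1 \<gamma> \<in> B}"

lemma closed_geo_between:
  assumes "closed A" "closed B"
  shows "closed (geo_between A B)"
proof -
  have "closed (ev 0 -` A)" "closed (ev 1 -` B)"
    by (intro closed_vimage assms continuous_on_ev; simp)+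
  moreover have "geo_between A B = Geo \<inter> ev 0 -` A \<inter> ev 1 -` B"
    by (auto simp: geo_between_def)
  ultimately show ?thesis
    using closed_Geo by (metis closed_Int)
qed

text \<open>Both curves are \<open>L\<close>-Lipschitz, so each moves at most \<open>L / n\<close>
  between a time and the grid point below it.\<close>

lemma dist_Geo_le_grid:
  fixes n :: nat
  assumes g: "\<gamma> \<in> Geo" "dist (ev 0 \<gamma>) (ev 1 \<gamma>) \<le> L" and h: "\<eta> \<in> Geo" "dist (ev 0 \<eta>) (ev 1 \<eta>) \<le> L"
    and n: "0 < n" and e: "\<And>i. i \<le> n \<Longrightarrow> dist (ev (i / n) \<gamma>) (ev (i / n) \<eta>) \<le> e"
  shows "dist \<gamma> \<eta> \<le> e + 2 * L / n"
proof (rule dist_curve_le)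
  fix t :: real assume t: "t \<in> {0..1}"
  define i where "i = nat \<lfloor>t * n\<rfloor>"
  have i: "real i \<le> t * n" "t * n < i + 1"
    using t n unfolding i_def by (auto simp: add.commute[of _ "1::real"], linarith?)
  have "t * n \<le> n" using t by (simp add: mult_left_le_one_le)
  then have "i \<le> n" using i(1) by simp
  have s: "i / n \<in> {0..1}" using \<open>i \<le> n\<close> n by (auto simp: divide_simps)
  have st: "\<bar>t - i / n\<bar> \<le> 1 / n"
  proof -
    have "t - i / n = (t * n - i) / n" using n by (simp add: field_simps)
    then show ?thesis using i n by (simp add: divide_right_mono)
  qed
  have *: "dist (ev t \<zeta>) (ev (i / n) \<zeta>) \<le> L / n"
    if "\<zeta> \<in> Geo" "dist (ev 0 \<zeta>) (ev 1 \<zeta>) \<le> L" for \<zeta> :: "'a curve"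
  proof -
    have "dist (ev t \<zeta>) (ev (i / n) \<zeta>) = \<bar>t - i / n\<bar> * dist (ev 0 \<zeta>) (ev 1 \<zeta>)"
      by (rule GeoD[OF that(1) t s])
    also have "\<dots> \<le> 1 / n * L"
      using st that(2) by (intro mult_mono) auto
    finally show ?thesis by simp
  qed
  have "dist (ev t \<gamma>) (ev t \<eta>) \<le> dist (ev t \<gamma>) (ev (i / n) \<gamma>)
      + dist (ev (i / n) \<gamma>) (ev (i / n) \<eta>) + dist (ev (i / n) \<eta>) (ev t \<eta>)"
    using dist_triangle[of "ev t \<gamma>" "ev t \<eta>" "ev (i / n) \<gamma>"]
      dist_triangle[of "ev (i / n) \<gamma>" "ev t \<eta>" "ev (i / n) \<eta>"] by linarith
  also have "\<dots> \<le> L / n + e + L / n"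
    using *[OF g] *[OF h] e[OF \<open>i \<le> n\<close>] by (intro add_mono) (auto simp: dist_commute)
  finally show "dist (ev t \<gamma>) (ev t \<eta>) \<le> e + 2 * L / n" by simp
qed

text \<open>The Arzela-Ascoli argument: a geodesic is coded by the net points close to it at the
  grid times. There are finitely many codes, and one representative per code forms the net.\<close>

lemma totally_bounded_Geo:
  fixes S :: "'a::metric_space curve set"
  assumes S: "S \<subseteq> Geo" and K: "compact K" "\<And>\<gamma> t. \<gamma> \<in> S \<Longrightarrow> t \<in> {0..1} \<Longrightarrow> ev t \<gamma> \<in> K" and "0 < e"
  shows "\<exists>T. finite T \<and> T \<subseteq> S \<and> S \<subseteq> (\<Union>\<gamma>\<in>T. ball \<gamma> e)"
proof -
  define L where "L = diameter K"
  have L: "dist (ev 0 \<gamma>) (ev 1 \<gamma>) \<le> L" if "\<gamma> \<in> S" for \<gamma>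
    unfolding L_def using that
    by (intro diameter_bounded_bound compact_imp_bounded K) auto
  \<comment> \<open>Curves with equal codes differ by at most \<open>2 * (e / 8) = e / 4\<close> on
    the grid, and this \<open>n\<close> makes the interpolation error \<open>2 * L / n\<close>
    smaller than \<open>e / 2\<close>.\<close>
  obtain n :: nat where n: "8 * \<bar>L\<bar> / e < n" using reals_Archimedean2 by blast
  moreover have "0 \<le> 8 * \<bar>L\<bar> / e" using \<open>0 < e\<close> by simp
  ultimately have "0 < n" by (cases n) auto
  have "8 * \<bar>L\<bar> < e * n" using n \<open>0 < e\<close> by (simp add: divide_simps mult.commute)
  then have nL: "2 * L / n < e / 2" using \<open>0 < n\<close> \<open>0 < e\<close> by (simp add: divide_simps mult.commute)
  obtain P where P: "finite P" "K \<subseteq> (\<Union>p\<in>P. ball p (e / 8))"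
    using K(1)[unfolded compact_eq_totally_bounded] \<open>0 < e\<close> by (metis divide_pos_pos zero_less_numeral)
  have "\<exists>p\<in>P. dist p (ev (i / n) \<gamma>) < e / 8" if "\<gamma> \<in> S" "i \<le> n" for \<gamma> and i :: nat
  proof -
    have "ev (i / n) \<gamma> \<in> K" using that \<open>0 < n\<close> by (intro K) auto
    then show ?thesis using P(2) unfolding mem_ball[symmetric] by blast
  qed
  then obtain p where p: "\<And>\<gamma> i. \<gamma> \<in> S \<Longrightarrow> i \<le> n \<Longrightarrow> p \<gamma> i \<in> P \<and> dist (p \<gamma> i) (ev (real i / n) \<gamma>) < e / 8"
    by metis
  define code where "code \<gamma> = restrict (p \<gamma>) {..n}" for \<gamma>
  have "code ` S \<subseteq> PiE {..n} (\<lambda>_. P)"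
    using p by (auto simp: code_def simp del: restrict_apply intro!: restrict_PiE[THEN iffD2])
  then have fin: "finite (code ` S)"
    by (rule finite_subset) (intro finite_PiE P(1) finite_atMost)
  show ?thesis
  proof (intro exI conjI subsetI)
    show "finite (inv_into S code ` code ` S)" using fin by simp
    show "\<gamma> \<in> S" if "\<gamma> \<in> inv_into S code ` code ` S" for \<gamma>
      using that by (auto intro: inv_into_into)
    fix \<gamma> assume g: "\<gamma> \<in> S"
    define \<eta> where "\<eta> = inv_into S code (code \<gamma>)"
    have h: "\<eta> \<in> S" "code \<eta> = code \<gamma>"
      using g by (auto simp: \<eta>_def inv_into_into f_inv_into_f)
    have "dist \<eta> \<gamma> \<le> e / 4 + 2 * L / n"
    proof (rule dist_Geo_le_grid)
      fix i assume i: "i \<le> n"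
      have "p \<eta> i = p \<gamma> i" using fun_cong[OF h(2), of i] i by (simp add: code_def)
      then have "dist (p \<gamma> i) (ev (i / n) \<gamma>) < e / 8" "dist (p \<gamma> i) (ev (i / n) \<eta>) < e / 8"
        using p[OF g i] p[OF h(1) i] by auto
      then show "dist (ev (i / n) \<eta>) (ev (i / n) \<gamma>) \<le> e / 4"
        using dist_triangle3[of "ev (i / n) \<eta>" "ev (i / n) \<gamma>" "p \<gamma> i"] by simp
    qed (use g h S L \<open>0 < n\<close> in auto)
    also have "\<dots> < e" using nL \<open>0 < e\<close> by simp
    finally show "\<gamma> \<in> (\<Union>\<gamma>\<in>inv_into S code ` code ` S. ball \<gamma> e)"
      using g by (auto simp: \<eta>_def)
  qed
qed

text \<open>The geodesic identity survives pointwise limits and forces continuity, so the limit is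
  again a curve; the Cauchy estimate, uniform in time, then gives convergence in the supremum
  distance.\<close>

lemma complete_Geo:
  fixes S :: "'a::complete_space curve set"
  assumes "closed S" "S \<subseteq> Geo"
  shows "Topological_Spaces.complete S"
proof (rule completeI)
  fix f :: "nat \<Rightarrow> 'a curve" assume f: "\<forall>n. f n \<in> S" "Cauchy f"
  have "convergent (\<lambda>n. ev t (f n))" if "t \<in> {0..1}" for t
  proof (rule Cauchy_convergent)
    show "Cauchy (\<lambda>n. ev t (f n))"
      unfolding Cauchy_def
    proof (intro allI impI)
      fix e :: real assume "0 < e"
      with f(2) obtain N where N: "\<And>m n. N \<le> m \<Longrightarrow> N \<le> n \<Longrightarrow> dist (f m) (f n) < e"
        unfolding Cauchy_def by blast
      have "dist (ev t (f m)) (ev t (f n)) < e" if "N \<le> m" "N \<le> n" for m n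
        using dist_ev_le[OF \<open>t \<in> {0..1}\<close>, of "f m" "f n"] N[OF that] by linarith
      then show "\<exists>N. \<forall>m\<ge>N. \<forall>n\<ge>N. dist (ev t (f m)) (ev t (f n)) < e" by blast
    qed
  qed
  then obtain l where l: "\<And>t. t \<in> {0..1} \<Longrightarrow> (\<lambda>n. ev t (f n)) \<longlonglongrightarrow> l t"
    unfolding convergent_def by metis
  have "dist (l s) (l t) = \<bar>s - t\<bar> * dist (l 0) (l 1)" if "s \<in> {0..1}" "t \<in> {0..1}" for s t
  proof (rule LIMSEQ_unique)
    show "(\<lambda>n. dist (ev s (f n)) (ev t (f n))) \<longlonglongrightarrow> dist (l s) (l t)"
      by (intro tendsto_dist l that)
    have "(\<lambda>n. \<bar>s - t\<bar> * dist (ev 0 (f n)) (ev 1 (f n))) \<longlonglongrightarrow> \<bar>s - t\<bar> * dist (l 0) (l 1)"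
      by (intro tendsto_intros l) auto
    moreover have "dist (ev s (f n)) (ev t (f n)) = \<bar>s - t\<bar> * dist (ev 0 (f n)) (ev 1 (f n))" for n
      using f assms(2) that by (intro GeoD) auto
    ultimately show "(\<lambda>n. dist (ev s (f n)) (ev t (f n))) \<longlonglongrightarrow> \<bar>s - t\<bar> * dist (l 0) (l 1)"
      by simp
  qed
  from Geo_exists_curve[of l, OF this] obtain \<gamma> where g: "\<gamma> \<in> Geo" "\<And>t. t \<in> {0..1} \<Longrightarrow> ev t \<gamma> = l t"
    by auto
  have "f \<longlonglongrightarrow> \<gamma>"
  proof (rule metric_LIMSEQ_I)
    fix r :: real assume "0 < r"
    then obtain N where N: "\<And>m n. m \<ge> N \<Longrightarrow> n \<ge> N \<Longrightarrow> dist (f m) (f n) < r / 2"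
      using f(2) half_gt_zero[OF \<open>0 < r\<close>] unfolding Cauchy_def by blast
    have "dist (f n) \<gamma> < r" if n: "n \<ge> N" for n
    proof -
      have "dist (f n) \<gamma> \<le> r / 2"
      proof (rule dist_curve_le)
        fix t :: real assume t: "t \<in> {0..1}"
        have "(\<lambda>m. dist (ev t (f n)) (ev t (f m))) \<longlonglongrightarrow> dist (ev t (f n)) (l t)"
          by (intro tendsto_dist tendsto_const l t)
        moreover have "dist (ev t (f n)) (ev t (f m)) \<le> r / 2" if "N \<le> m" for m
          using N[OF n that] dist_ev_le[OF t, of "f n" "f m"] by linarith
        ultimately show "dist (ev t (f n)) (ev t \<gamma>) \<le> r / 2"
          unfolding g(2)[OF t] by (intro LIMSEQ_le_const2) auto
      qed
      then show ?thesis using \<open>0 < r\<close> by simp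
    qed
    then show "\<exists>no. \<forall>n\<ge>no. dist (f n) \<gamma> < r" by blast
  qed
  moreover have "\<gamma> \<in> S"
    using closed_sequentially[OF assms(1) _ \<open>f \<longlonglongrightarrow> \<gamma>\<close>] f by blast
  ultimately show "\<exists>l\<in>S. f \<longlonglongrightarrow> l" by blast
qed

lemma compact_Geo:
  fixes S :: "'a::complete_space curve set"
  assumes "closed S" "S \<subseteq> Geo" "compact K" "\<And>\<gamma> t. \<gamma> \<in> S \<Longrightarrow> t \<in> {0..1} \<Longrightarrow> ev t \<gamma> \<in> K"
  shows "compact S"
  unfolding compact_eq_totally_bounded
proof (intro conjI allI impI)
  show "Topological_Spaces.complete S" by (rule complete_Geo[OF assms(1,2)])
  fix e :: real assume "0 < e"
  from totally_bounded_Geo[OF assms(2-4) this]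
  show "\<exists>T. finite T \<and> S \<subseteq> (\<Union>\<gamma>\<in>T. ball \<gamma> e)" by auto
qed

lemma compact_geo_between:
  fixes A :: "'a::complete_space set"
  assumes proper: "\<And>(x::'a) r. compact (cball x r)"
    and "closed A" "bounded A" "closed B" "bounded B"
  shows "compact (geo_between A B)"
proof -
  have "bounded (A \<union> B)" using assms(3,5) by simp
  then obtain z :: 'a and R where R: "A \<union> B \<subseteq> cball z R"
    unfolding bounded_subset_cball by blast
  \<comment> \<open>Endpoints in \<open>cball z R\<close> are at most \<open>2 * R\<close> apart,
    and a geodesic stays within its length of its start, hence \<open>3 * R\<close>.\<close>
  show ?thesis
  proof (rule compact_Geo[OF closed_geo_between _ proper[of z "3 * R"]])
    fix \<gamma> :: "'a curve" and t :: real assume g: "\<gamma> \<in> geo_between A B" and t: "t \<in> {0..1}"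
    have "\<gamma> \<in> Geo" and z: "dist z (ev 0 \<gamma>) \<le> R" "dist z (ev 1 \<gamma>) \<le> R"
      using g R by (auto simp: geo_between_def)
    have "dist (ev 0 \<gamma>) (ev t \<gamma>) = \<bar>0 - t\<bar> * dist (ev 0 \<gamma>) (ev 1 \<gamma>)"
      using t by (intro GeoD[OF \<open>\<gamma> \<in> Geo\<close>]) auto
    also have "\<dots> \<le> 1 * dist (ev 0 \<gamma>) (ev 1 \<gamma>)"
      using t by (intro mult_right_mono) auto
    finally have "dist (ev 0 \<gamma>) (ev t \<gamma>) \<le> dist (ev 0 \<gamma>) (ev 1 \<gamma>)" by simp
    then show "ev t \<gamma> \<in> cball z (3 * R)"
      using z dist_triangle3[of "ev 0 \<gamma>" "ev 1 \<gamma>" z] dist_triangle[of z "ev t \<gamma>" "ev 0 \<gamma>"]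
      by simp
  qed (use assms in \<open>auto simp: geo_between_def\<close>)
qed

text \<open>If closed balls are compact, this exhibits \<open>Geo\<close> as \<sigma>-compact, the
  source of both Borel images and separability below.\<close>

lemma Geo_eq_UN: "Geo = (\<Union>n::nat. geo_between (cball z n) (cball z n))"
proof (intro equalityI subsetI)
  fix \<gamma> :: "'a curve" assume "\<gamma> \<in> Geo"
  moreover obtain n :: nat where "max (dist z (ev 0 \<gamma>)) (dist z (ev 1 \<gamma>)) \<le> n"
    using real_arch_simple by blast
  ultimately show "\<gamma> \<in> (\<Union>n::nat. geo_between (cball z n) (cball z n))"
    by (auto simp: geo_between_def)
qed (auto simp: geo_between_def)

text \<open>Continuous images of closed sets are in general only analytic. Here \<sigma>-compactness
  of \<open>Geo\<close> makes the image a countable union of compact sets.\<close>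

lemma borel_image_Geo:
  fixes h :: "'a::complete_space curve \<Rightarrow> 'b::t2_space"
  assumes proper: "\<And>(x::'a) r. compact (cball x r)"
    and "closed F" "continuous_on UNIV h"
  shows "h ` (F \<inter> Geo) \<in> sets borel"
proof -
  obtain z :: 'a where True by blast
  have "h ` (F \<inter> Geo) = (\<Union>n::nat. h ` (F \<inter> geo_between (cball z n) (cball z n)))"
    by (subst Geo_eq_UN[of z]) blast
  moreover have "compact (h ` (F \<inter> geo_between (cball z (real n)) (cball z n)))" for n
    using assms
    by (intro compact_continuous_image closed_Int_compact compact_geo_between)
      (auto intro: continuous_on_subset)
  then have "closed (h ` (F \<inter> geo_between (cball z (real n)) (cball z n)))" for n
    by (rule compact_imp_closed)
  ultimately show ?thesis by simp
qed

lemma Geo_separable: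
  assumes proper: "\<And>(x::'a::complete_space) r. compact (cball x r)"
  shows "\<exists>c :: nat \<Rightarrow> 'a curve. \<forall>\<gamma>\<in>Geo. \<forall>e>0. \<exists>k. dist (c k) \<gamma> < e"
proof -
  obtain z :: 'a where True by blast
  define S where "S n = geo_between (cball z (real n)) (cball z n)" for n
  have "compact (S n)" for n
    unfolding S_def by (intro compact_geo_between proper) auto
  then have "\<exists>T. finite T \<and> S n \<subseteq> (\<Union>\<gamma>\<in>T. ball \<gamma> (1 / Suc j))" for n j
    unfolding compact_eq_totally_bounded by (metis of_nat_0_less_iff zero_less_Suc zero_less_divide_1_iff)
  then obtain T where T: "\<And>n j. finite (T n j)" "\<And>n j. S n \<subseteq> (\<Union>\<gamma>\<in>T n j. ball \<gamma> (1 / Suc j))"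
    by metis
  \<comment> \<open>The inserted element makes \<open>U\<close> nonempty for
    \<open>from_nat_into\<close>; an extra point does not affect density.\<close>
  define U where "U = insert undefined (\<Union>n j. T n j)"
  have U: "countable U" "U \<noteq> {}" unfolding U_def using T(1)
    by (auto intro!: countable_UN intro: countable_finite)
  show ?thesis
  proof (intro exI[of _ "from_nat_into U"] ballI allI impI)
    fix \<gamma> :: "'a curve" and e :: real assume "\<gamma> \<in> Geo" "0 < e"
    then obtain n where "\<gamma> \<in> S n" using Geo_eq_UN[of z] by (auto simp: S_def)
    obtain j where "1 / Suc j < e" using \<open>0 < e\<close> by (metis nat_approx_posE)
    obtain \<eta> where "\<eta> \<in> T n j" "dist \<eta> \<gamma> < 1 / Suc j" using T(2)[of n j] \<open>\<gamma> \<in> S n\<close> by auto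
    moreover then have "\<eta> \<in> U" by (auto simp: U_def)
    ultimately show "\<exists>k. dist (from_nat_into U k) \<gamma> < e"
      using from_nat_into_surj[OF U(1)] \<open>1 / Suc j < e\<close> by (metis less_trans)
  qed
qed

section \<open>Measurable selection of geodesics\<close>

text \<open>The preferred set \<open>A\<close> serves the uniqueness argument, where two selections
  are pushed into disjoint sets wherever possible; \<open>A = UNIV\<close> gives a plain
  selection.\<close>

lemma geodesic_selection:
  fixes A :: "'a::polish_space curve set"
  assumes proper: "\<And>(x::'a) r. compact (cball x r)"
    and geodesic: "geodesic_space TYPE('a)" and "closed A"
  shows "\<exists>G\<in>borel_measurable (borel :: ('a \<times> 'a) measure). \<forall>x y. G (x, y) \<in> geo_between {x} {y} \<and>
    (geo_between {x} {y} \<inter> A \<noteq> {} \<longrightarrow> G (x, y) \<in> A)"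
proof -
  define \<Gamma> :: "'a \<times> 'a \<Rightarrow> 'a curve set" where "\<Gamma> p = geo_between {fst p} {snd p}" for p
  define \<Gamma>' where "\<Gamma>' p = (if \<Gamma> p \<inter> A = {} then \<Gamma> p else \<Gamma> p \<inter> A)" for p
  define H where "H F = {p. \<Gamma> p \<inter> F \<noteq> {}}" for F
  have H: "H F \<in> sets borel" if "closed F" for F
  proof -
    have "H F = (\<lambda>\<gamma>. (ev 0 \<gamma>, ev 1 \<gamma>)) ` (F \<inter> Geo)"
      by (force simp: H_def \<Gamma>_def geo_between_def)
    also have "\<dots> \<in> sets borel"
      by (intro borel_image_Geo proper that continuous_on_Pair continuous_on_ev) auto
    finally show ?thesis .
  qed
  obtain c :: "nat \<Rightarrow> 'a curve" where c: "\<And>\<gamma> e. \<gamma> \<in> Geo \<Longrightarrow> 0 < e \<Longrightarrow> \<exists>k. dist (c k) \<gamma> < e"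
    using Geo_separable[OF proper] by blast
  have "\<exists>G\<in>borel_measurable borel. \<forall>p\<in>space borel. G p \<in> \<Gamma>' p"
  proof (rule compact_valued_measurable_selection)
    fix p
    have "compact (\<Gamma> p)"
      unfolding \<Gamma>_def by (intro compact_geo_between proper) auto
    then show "compact (\<Gamma>' p)"
      using \<open>closed A\<close> by (auto simp: \<Gamma>'_def intro: compact_Int_closed)
    show "\<Gamma>' p \<noteq> {}"
    proof -
      obtain \<gamma> where "\<gamma> \<in> Geo" "ev 0 \<gamma> = fst p" "ev 1 \<gamma> = snd p"
        using geodesic unfolding geodesic_space_def by blast
      then have "\<gamma> \<in> \<Gamma> p" by (simp add: \<Gamma>_def geo_between_def)
      then show ?thesis by (auto simp: \<Gamma>'_def)
    qed
    show "\<exists>k. dist (c k) \<gamma> < e" if "\<gamma> \<in> \<Gamma>' p" "0 < e" for \<gamma> e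
      using that by (intro c) (auto simp: \<Gamma>'_def \<Gamma>_def geo_between_def split: if_splits)
  next
    fix F :: "'a curve set" assume "closed F"
    \<comment> \<open>\<open>\<Gamma>' p\<close> meets \<open>F\<close> in one of two ways:
      \<open>\<Gamma> p\<close> misses \<open>A\<close> and meets \<open>F\<close>, or
      \<open>\<Gamma> p\<close> meets \<open>A \<inter> F\<close>.\<close>
    then have "H F - H A \<union> H (A \<inter> F) \<in> sets borel"
      using \<open>closed A\<close> by (intro sets.Un sets.Diff H closed_Int)
    also have "H F - H A \<union> H (A \<inter> F) = {p \<in> space borel. \<Gamma>' p \<inter> F \<noteq> {}}"
      by (auto simp: H_def \<Gamma>'_def)
    finally show "{p \<in> space borel. \<Gamma>' p \<inter> F \<noteq> {}} \<in> sets borel" .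
  qed
  then obtain G where G: "G \<in> borel_measurable borel" "\<And>p. G p \<in> \<Gamma>' p" by auto
  have "G (x, y) \<in> geo_between {x} {y} \<and> (geo_between {x} {y} \<inter> A \<noteq> {} \<longrightarrow> G (x, y) \<in> A)" for x y
    using G(2)[of "(x, y)"] by (auto simp: \<Gamma>'_def \<Gamma>_def split: if_splits)
  then show ?thesis using G(1) by blast
qed

section \<open>Uniform measures on metric measure spaces\<close>

lemma
  assumes "metric_measure_space m"
  shows metric_measure_space_sets: "sets m = sets borel"
    and metric_measure_space_space: "space m = UNIV"
    and metric_measure_space_finite: "B \<in> sets borel \<Longrightarrow> bounded B \<Longrightarrow> emeasure m B < \<infinity>"
  using assms sets_eq_imp_space_eq[of m borel] by (auto simp: metric_measure_space_def)

lemma metric_measure_space_ball: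
  assumes "metric_measure_space m" "0 < r"
  shows "0 < emeasure m (ball x r)"
proof -
  have "x \<in> measure_support m" using assms(1) by (simp add: metric_measure_space_def)
  then show ?thesis
    unfolding measure_support_def using assms(2) by (metis (mono_tags) centre_in_ball mem_Collect_eq open_ball)
qed

lemma metric_measure_space_sigma_finite:
  fixes m :: "'a::polish_space measure"
  assumes "metric_measure_space m"
  shows "sigma_finite_measure m"
proof
  obtain z :: 'a where True by blast
  have "\<Union>(range (\<lambda>n::nat. ball z n)) = UNIV"
    by (auto intro: reals_Archimedean2)
  then show "\<exists>A. countable A \<and> A \<subseteq> sets m \<and> \<Union>A = space m \<and> (\<forall>a\<in>A. emeasure m a \<noteq> \<infinity>)"
    using metric_measure_space_finite[OF assms, of "ball z _"]
    by (intro exI[of _ "range (\<lambda>n::nat. ball z n)"])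
      (auto simp: metric_measure_space_sets[OF assms] metric_measure_space_space[OF assms] less_top)
qed

lemma closed_measure_support: "closed (measure_support \<mu>)"
proof -
  have "- measure_support \<mu> = \<Union>{U. open U \<and> emeasure \<mu> U = 0}"
    by (auto simp: measure_support_def zero_less_iff_neq_zero)
  also have "open \<dots>" by (intro open_Union) auto
  finally show ?thesis by (simp add: closed_def)
qed

lemma uniform_measure_Prob:
  assumes "sets m = sets borel" "0 < emeasure m A" "emeasure m A < \<infinity>"
  shows "uniform_measure m A \<in> Prob"
  using assms by (auto simp: Prob_def intro!: prob_space_uniform_measure)

lemma absolutely_continuous_uniform_measure:
  assumes "A \<in> sets m"
  shows "absolutely_continuous m (uniform_measure m A)"
  unfolding uniform_measure_def using assms by (intro absolutely_continuousI_density) auto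

lemma AE_uniform_measure_mem:
  assumes "A \<in> sets m"
  shows "AE x in uniform_measure m A. x \<in> A"
  using assms by (intro AE_uniform_measureI) auto

lemma Prob2_bounded:
  fixes \<mu> :: "'a::polish_space measure"
  assumes \<mu>: "\<mu> \<in> Prob" and A: "AE x in \<mu>. x \<in> A" "bounded A"
  shows "\<mu> \<in> Prob2"
proof -
  interpret prob_space \<mu> using \<mu> by (simp add: Prob_def)
  obtain z r where r: "A \<subseteq> cball z r" using A(2) unfolding bounded_subset_cball by blast
  have "(\<integral>\<^sup>+ y. ennreal ((dist z y)\<^sup>2) \<partial>\<mu>) \<le> (\<integral>\<^sup>+ y. ennreal (r\<^sup>2) \<partial>\<mu>)"
    using A(1) r by (intro nn_integral_mono_AE) (auto elim!: eventually_mono intro!: ennreal_leI power_mono)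
  also have "\<dots> < \<infinity>" by (simp add: emeasure_space_1)
  finally show ?thesis using \<mu> by (auto simp: Prob2_def)
qed

lemma uniform_measure_Prob2:
  fixes m :: "'a::polish_space measure"
  assumes m: "metric_measure_space m" and A: "A \<in> sets borel" "bounded A" "0 < emeasure m A"
  shows "uniform_measure m A \<in> Prob2"
  using metric_measure_space_finite[OF m A(1,2)] metric_measure_space_sets[OF m] A
  by (intro Prob2_bounded[of _ A] uniform_measure_Prob AE_uniform_measure_mem) auto

text \<open>\<open>A\<close> is only asked to lie in a compact set, so open balls qualify once
  closed balls are known to be compact.\<close>

lemma uniform_measure_Prob_c_ac:
  fixes m :: "'a::polish_space measure"
  assumes m: "metric_measure_space m" and A: "A \<in> sets borel" "0 < emeasure m A"
    and C: "compact C" "A \<subseteq> C"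
  shows "uniform_measure m A \<in> Prob_c_ac m"
proof -
  note s = metric_measure_space_sets[OF m]
  have "bounded A" using C compact_imp_bounded bounded_subset by blast
  have "measure_support (uniform_measure m A) \<subseteq> C"
  proof
    fix x assume x: "x \<in> measure_support (uniform_measure m A)"
    show "x \<in> C"
    proof (rule ccontr)
      assume "x \<notin> C"
      moreover have "open (- C)" using C(1) by (simp add: compact_imp_closed open_Compl)
      ultimately have "0 < emeasure (uniform_measure m A) (- C)"
        using x by (auto simp: measure_support_def)
      also have "emeasure (uniform_measure m A) (- C) = emeasure m (A \<inter> - C) / emeasure m A"
        using A s \<open>open (- C)\<close> by (intro emeasure_uniform_measure) auto
      also have "A \<inter> - C = {}" using C by auto
      finally show False by simp
    qed
  qed
  then have "compact (measure_support (uniform_measure m A))"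
    using C(1) closed_measure_support by (metis compact_Int_closed inf.absorb2)
  then show ?thesis
    using metric_measure_space_finite[OF m A(1) \<open>bounded A\<close>] A s
    by (auto simp: Prob_c_ac_def intro!: uniform_measure_Prob absolutely_continuous_uniform_measure)
qed

lemma dens_nonneg: "0 \<le> dens m \<mu> x"
  by (simp add: dens_def)

lemma dens_uniform_measure:
  assumes "sigma_finite_measure m" "A \<in> sets m" "0 < emeasure m A" "emeasure m A < \<infinity>"
  shows "AE x in uniform_measure m A. dens m (uniform_measure m A) x = 1 / measure m A"
proof -
  interpret sigma_finite_measure m by fact
  have "AE x in m. indicator A x / emeasure m A = RN_deriv m (uniform_measure m A) x"
    using assms by (intro RN_deriv_unique) (auto simp: uniform_measure_def)
  moreover have "1 / emeasure m A = ennreal (1 / measure m A)"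
    using assms divide_ennreal[of 1 "measure m A"]
    by (simp add: emeasure_eq_ennreal_measure zero_less_measure_iff)
  ultimately show ?thesis
    using assms by (intro AE_uniform_measureI) (auto simp: dens_def measure_nonneg elim!: eventually_mono, metis enn2real_ennreal divide_nonneg_nonneg measure_nonneg zero_le_one)
qed

section \<open>Density bounds along optimal plans\<close>

lemma powr_neg_le_cancel:
  fixes x y p :: real
  assumes "0 \<le> x" "0 < y" "0 < p" "y powr (- p) \<le> x powr (- p)"
  shows "x \<le> y"
proof (rule ccontr)
  assume "\<not> x \<le> y"
  then have "x powr (- p) < y powr (- p)"
    using assms by (intro powr_less_mono2_neg) auto
  then show False using assms by simp
qed

text \<open>Only the \<open>\<rho>\<^sub>0\<close>-term of the curvature-dimension inequality is kept. The density is positive along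
  almost every curve because \<open>0 powr a = 0\<close> would contradict the positive lower bound.\<close>

lemma OptGeo_emeasure_le:
  fixes m :: "'a::polish_space measure"
  assumes Q: "1 \<le> Q" and N: "1 < N" and monge: "Monge_space m" and qcd: "QCD Q K N m"
    and A: "A \<in> sets borel" "0 < emeasure m A" "compact C" "A \<subseteq> C"
    and \<mu>: "\<mu> \<in> Prob_c_ac m" "\<mu> \<in> Prob2" and \<pi>: "\<pi> \<in> OptGeo (uniform_measure m A) \<mu>"
    and D: "AE \<gamma> in \<pi>. dist (ev 0 \<gamma>) (ev 1 \<gamma>) \<le> D"
    and t: "0 < t" "t < 1" and B: "B \<in> sets borel"
  shows "emeasure \<pi> (ev t -` B) \<le>
    ennreal (Q * (distortion_const K N D / (1 - t)) powr N / measure m A) * emeasure m B"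
proof -
  have m: "metric_measure_space m" using monge by (simp add: Monge_space_def)
  note sets_m [simp, measurable_cong] = metric_measure_space_sets[OF m]
  interpret m: sigma_finite_measure m by (rule metric_measure_space_sigma_finite[OF m])
  have "bounded A" using A compact_imp_bounded bounded_subset by blast
  note finA = metric_measure_space_finite[OF m A(1) this]
  have mA: "0 < measure m A" using A(2) finA by (simp add: measure_def enn2real_positive_iff)
  have sets_\<pi> [simp, measurable_cong]: "sets \<pi> = sets borel" and P: "prob_space \<pi>"
    and ev0: "distr \<pi> borel (ev 0) = uniform_measure m A"
    using \<pi> by (auto simp: OptGeo_def Prob_def)
  have space_\<pi> [simp]: "space \<pi> = UNIV" using sets_eq_imp_space_eq[OF sets_\<pi>] by simp
  have ev [measurable]: "ev s \<in> \<pi> \<rightarrow>\<^sub>M borel" if "s \<in> {0..1}" for s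
    using measurable_ev'[OF that] measurable_cong_sets[OF sets_\<pi> refl] by blast
  define \<nu> where "\<nu> = distr \<pi> borel (ev t)"
  interpret \<nu>: prob_space \<nu>
    unfolding \<nu>_def using P t by (intro prob_space.prob_space_distr ev) auto
  have ac: "absolutely_continuous m \<nu>"
    using monge \<pi> \<mu> t uniform_measure_Prob2[OF m A(1) \<open>bounded A\<close> A(2)]
      absolutely_continuous_uniform_measure[of A m] A(1)
    by (auto simp: Monge_space_def \<nu>_def)
  define c where "c = distortion_const K N D"
  have c: "1 \<le> c" by (simp add: c_def distortion_const_ge_1)
  \<comment> \<open>Chosen so that \<open>R powr (- 1 / N)\<close> equals the kept term of the
    curvature inequality, with the initial density \<open>1 / measure m A\<close> and the
    coefficient replaced by its lower bound \<open>(1 - t) / c\<close>.\<close>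
  define R where "R = Q * (c / (1 - t)) powr N / measure m A"
  have R: "0 < R" using Q c t mA by (simp add: R_def)
  have Rp: "R powr (- 1 / N) = Q powr (- 1 / N) * ((1 - t) / c * (1 / measure m A) powr (- 1 / N))"
  proof -
    have "((c / (1 - t)) powr N) powr (- 1 / N) = (1 - t) / c"
      using c t N by (simp add: powr_powr powr_minus_divide)
    moreover have "R = Q * ((c / (1 - t)) powr N * (1 / measure m A))" by (simp add: R_def)
    ultimately show ?thesis
      using Q c t mA by (simp only: powr_mult)
  qed
  have AE0: "AE \<gamma> in \<pi>. dens m (uniform_measure m A) (ev 0 \<gamma>) = 1 / measure m A"
    using dens_uniform_measure[OF m.sigma_finite_measure_axioms _ A(2) finA] A(1)
    by (intro AE_distrD[OF ev[of 0]]) (simp_all only: ev0, simp_all)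
  have "AE \<gamma> in \<pi>.
          ennreal (dens m \<nu> (ev t \<gamma>) powr (- 1 / N)) \<ge>
          ennreal (Q powr (- 1 / N)) *
            (tau_coeff K N (1 - t) (dist (ev 0 \<gamma>) (ev 1 \<gamma>)) *
               ennreal (dens m (uniform_measure m A) (ev 0 \<gamma>) powr (- 1 / N)) +
             tau_coeff K N t (dist (ev 0 \<gamma>) (ev 1 \<gamma>)) *
               ennreal (dens m \<mu> (ev 1 \<gamma>) powr (- 1 / N)))"
    using qcd \<mu>(1) \<pi> t uniform_measure_Prob_c_ac[OF m A(1,2,3,4)]
    unfolding QCD_def \<nu>_def by auto
  then have "AE \<gamma> in \<pi>. dens m \<nu> (ev t \<gamma>) \<le> R"
    using AE0 D
  proof eventually_elim
    case (elim \<gamma>)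
    let ?d = "dist (ev 0 \<gamma>) (ev 1 \<gamma>)"
    have split: "ennreal (a * (b * d)) = ennreal a * (ennreal b * ennreal d)" if "0 \<le> a" "0 \<le> b" for a b d
      using that by (simp add: ennreal_mult')
    have "ennreal (R powr (- 1 / N)) =
        ennreal (Q powr (- 1 / N)) * (ennreal ((1 - t) / c) * ennreal ((1 / measure m A) powr (- 1 / N)))"
      unfolding Rp using c t by (intro split) auto
    also have "\<dots> \<le> ennreal (Q powr (- 1 / N)) *
        (tau_coeff K N (1 - t) ?d * ennreal ((1 / measure m A) powr (- 1 / N)))"
      unfolding c_def using t N elim(3)
      by (intro mult_left_mono mult_right_mono tau_coeff_ge) auto
    also have "\<dots> \<le> ennreal (dens m \<nu> (ev t \<gamma>) powr (- 1 / N))"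
      using elim(1) unfolding elim(2)
      by (rule order_trans[rotated]) (intro mult_left_mono, auto)
    finally have "R powr (- 1 / N) \<le> dens m \<nu> (ev t \<gamma>) powr (- 1 / N)"
      by (simp add: ennreal_le_iff)
    then show ?case
      using powr_neg_le_cancel[of "dens m \<nu> (ev t \<gamma>)" R "1 / N"] R N
      by (simp add: dens_nonneg)
  qed
  moreover have "{x. dens m \<nu> x \<le> R} \<in> sets borel"
  proof -
    have "dens m \<nu> \<in> borel_measurable m" unfolding dens_def[abs_def] by measurable
    then have "dens m \<nu> \<in> borel_measurable borel" using measurable_cong_sets[OF sets_m refl] by blast
    then show ?thesis by measurable
  qed
  ultimately have "AE x in distr \<pi> borel (ev t). dens m \<nu> x \<le> R"
    using AE_distr_iff[OF ev[of t], of "\<lambda>x. dens m \<nu> x \<le> R"] t by simp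
  then have bound: "AE x in \<nu>. dens m \<nu> x \<le> R" by (simp only: \<nu>_def)
  have sets_\<nu>: "sets \<nu> = sets m" by (simp add: \<nu>_def)
  then have density: "density m (RN_deriv m \<nu>) = \<nu>"
    by (rule m.density_RN_deriv[OF ac])
  \<comment> \<open>A bound that holds \<open>\<nu>\<close>-a.e. holds \<open>m\<close>-a.e. where
    the density is positive; where the density vanishes it is trivial.\<close>
  have "AE x in density m (RN_deriv m \<nu>). dens m \<nu> x \<le> R"
    unfolding density by (rule bound)
  then have "AE x in m. 0 < RN_deriv m \<nu> x \<longrightarrow> dens m \<nu> x \<le> R"
    by (subst (asm) AE_density) (rule borel_measurable_RN_deriv)
  \<comment> \<open>\<open>dens\<close> sends an infinite density to 0, so a bound on
    \<open>dens\<close> bounds the density only where the latter is finite.\<close>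
  moreover have "AE x in m. RN_deriv m \<nu> x \<noteq> \<infinity>"
    by (rule m.RN_deriv_finite[OF \<nu>.sigma_finite_measure_axioms ac sets_\<nu>])
  ultimately have "AE x in m. RN_deriv m \<nu> x \<le> ennreal R"
  proof eventually_elim
    case (elim x)
    then show ?case
      using R by (cases "RN_deriv m \<nu> x") (auto simp: dens_def ennreal_le_iff zero_less_iff_neq_zero)
  qed
  then have "(\<integral>\<^sup>+ x. RN_deriv m \<nu> x * indicator B x \<partial>m) \<le> (\<integral>\<^sup>+ x. ennreal R * indicator B x \<partial>m)"
    by (intro nn_integral_mono_AE) (auto elim!: eventually_mono intro!: mult_right_mono)
  also have "(\<integral>\<^sup>+ x. RN_deriv m \<nu> x * indicator B x \<partial>m) = emeasure (density m (RN_deriv m \<nu>)) B"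
    using B by (subst emeasure_density) auto
  also have "\<dots> = emeasure \<pi> (ev t -` B)"
    unfolding density using B t by (simp add: \<nu>_def emeasure_distr)
  also have "(\<integral>\<^sup>+ x. ennreal R * indicator B x \<partial>m) = ennreal R * emeasure m B"
    using B by (simp add: nn_integral_cmult_indicator)
  finally show ?thesis by (simp add: R_def c_def)
qed

section \<open>Properness\<close>

lemma OptGeo_D:
  assumes "\<pi> \<in> OptGeo \<mu> \<nu>"
  shows "prob_space \<pi>" "sets \<pi> = sets borel" "AE \<gamma> in \<pi>. \<gamma> \<in> Geo"
    "distr \<pi> borel (ev 0) = \<mu>" "distr \<pi> borel (ev 1) = \<nu>"
  using assms by (auto simp: OptGeo_def Prob_def)

lemma ev_measurable_borel:
  assumes "sets \<pi> = sets borel" "t \<in> {0..1}"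
  shows "ev t \<in> \<pi> \<rightarrow>\<^sub>M borel"
  using measurable_ev'[OF assms(2)] measurable_cong_sets[OF assms(1) refl] by blast

lemma OptGeo_AE_ends:
  assumes "\<pi> \<in> OptGeo \<mu> \<nu>" "AE x in \<mu>. P x" "AE x in \<nu>. R x"
  shows "AE \<gamma> in \<pi>. \<gamma> \<in> Geo \<and> P (ev 0 \<gamma>) \<and> R (ev 1 \<gamma>)"
proof -
  note \<pi> = OptGeo_D[OF assms(1)]
  have "AE \<gamma> in \<pi>. P (ev 0 \<gamma>)"
    using assms(2) unfolding \<pi>(4)[symmetric]
    by (intro AE_distrD[OF ev_measurable_borel[OF \<pi>(2)]]) auto
  moreover have "AE \<gamma> in \<pi>. R (ev 1 \<gamma>)"
    using assms(3) unfolding \<pi>(5)[symmetric]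
    by (intro AE_distrD[OF ev_measurable_borel[OF \<pi>(2)]]) auto
  ultimately show ?thesis using \<pi>(3) by eventually_elim auto
qed

lemma compact_subset_ball_pos:
  fixes m :: "'a::polish_space measure"
  assumes m: "metric_measure_space m" and "0 < r"
  shows "\<exists>C. compact C \<and> C \<subseteq> ball x r \<and> 0 < emeasure m C"
proof -
  note s [simp] = metric_measure_space_sets[OF m]
  let ?\<mu> = "uniform_measure m (ball x r)"
  have b: "0 < emeasure m (ball x r)" "emeasure m (ball x r) < \<infinity>"
    using metric_measure_space_ball[OF m \<open>0 < r\<close>] metric_measure_space_finite[OF m] by auto
  interpret \<mu>: prob_space ?\<mu>
    using uniform_measure_Prob[OF s b] by (simp add: Prob_def)
  have "emeasure ?\<mu> (ball x r) = (SUP C\<in>{C. C \<subseteq> ball x r \<and> compact C}. emeasure ?\<mu> C)"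
    by (rule inner_regular) auto
  moreover have "0 < emeasure ?\<mu> (ball x r)"
    using b by (simp add: emeasure_uniform_measure less_top[symmetric])
  ultimately obtain C where C: "C \<subseteq> ball x r" "compact C" "0 < emeasure ?\<mu> C"
    by (auto simp: less_SUP_iff)
  have "C \<in> sets borel" using C(2) by (simp add: compact_imp_closed)
  then have "0 < emeasure m (ball x r \<inter> C) / emeasure m (ball x r)"
    using C(3) by (simp add: emeasure_uniform_measure)
  then have "0 < emeasure m (ball x r \<inter> C)"
    by (auto simp: zero_less_iff_neq_zero)
  then show ?thesis using C by (metis inf.absorb2)
qed

text \<open>Transport a fixed compact set near \<open>x0\<close> into a small ball around \<open>p\<close>: at a time \<open>t\<close> close to \<open>1\<close>,
  chosen independently of \<open>p\<close>, all the mass has arrived in \<open>ball p e\<close>, with bounded density.\<close>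

lemma QCD_ball_lower_bound:
  fixes m :: "'a::polish_space measure"
  assumes Q: "1 \<le> Q" and N: "1 < N" and monge: "Monge_space m" and qcd: "QCD Q K N m"
    and "0 \<le> R" "0 < e"
  shows "\<exists>b>0. \<forall>p\<in>cball x0 R. b \<le> emeasure m (ball p e)"
proof -
  have m: "metric_measure_space m" using monge by (simp add: Monge_space_def)
  note s [simp] = metric_measure_space_sets[OF m]
  obtain A where A: "compact A" "A \<subseteq> ball x0 1" "0 < emeasure m A"
    using compact_subset_ball_pos[OF m, of 1] by auto
  then have A': "A \<in> sets borel" "bounded A" by (auto simp: compact_imp_closed compact_imp_bounded)
  define D where "D = R + 1 + e"
  have D: "0 < D" using assms by (simp add: D_def)
  \<comment> \<open>After time \<open>t\<close> a geodesic has at most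
    \<open>(1 - t) * D \<le> e / 4\<close> left to travel, so if it ends in
    \<open>ball p (e / 2)\<close> it is already in \<open>ball p e\<close>. The maximum with
    \<open>1 / 2\<close> keeps \<open>t\<close> positive.\<close>
  define t where "t = max (1 / 2) (1 - e / (4 * D))"
  have t: "0 < t" "t < 1" using D \<open>0 < e\<close> by (auto simp: t_def)
  have "(1 - t) * D \<le> e / (4 * D) * D" using D by (intro mult_right_mono) (auto simp: t_def)
  then have tD: "(1 - t) * D < e / 2" using D \<open>0 < e\<close> by simp
  define c where "c = Q * (distortion_const K N D / (1 - t)) powr N / measure m A"
  have mA: "0 < measure m A"
    using A(3) metric_measure_space_finite[OF m A'] by (simp add: measure_def enn2real_positive_iff)
  have "0 < distortion_const K N D" using distortion_const_ge_1[of K N D] by linarith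
  then have c: "0 < c" using Q t mA by (simp add: c_def)
  have "ennreal (1 / c) \<le> emeasure m (ball p e)" if p: "p \<in> cball x0 R" for p
  proof -
    obtain A1 where A1: "compact A1" "A1 \<subseteq> ball p (e / 2)" "0 < emeasure m A1"
      using compact_subset_ball_pos[OF m, of "e / 2"] \<open>0 < e\<close> by auto
    then have A1': "A1 \<in> sets borel" "bounded A1" by (auto simp: compact_imp_closed compact_imp_bounded)
    note unif = uniform_measure_Prob2[OF m A' A(3)] uniform_measure_Prob2[OF m A1' A1(3)]
      uniform_measure_Prob_c_ac[OF m A1'(1) A1(3,1) subset_refl]
    obtain \<pi> where \<pi>: "\<pi> \<in> OptGeo (uniform_measure m A) (uniform_measure m A1)"
      using monge unif absolutely_continuous_uniform_measure[of A m] A'(1)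
      unfolding Monge_space_def by (metis s)
    note \<pi>D = OptGeo_D[OF \<pi>]
    interpret \<pi>: prob_space \<pi> by (rule \<pi>D)
    have AE: "AE \<gamma> in \<pi>. \<gamma> \<in> Geo \<and> ev 0 \<gamma> \<in> A \<and> ev 1 \<gamma> \<in> A1"
      using A' A1' by (intro OptGeo_AE_ends[OF \<pi>] AE_uniform_measure_mem) auto
    have dist: "dist (ev 0 \<gamma>) (ev 1 \<gamma>) \<le> D" if "ev 0 \<gamma> \<in> A" "ev 1 \<gamma> \<in> A1" for \<gamma>
    proof -
      have "dist x0 (ev 0 \<gamma>) < 1" "dist p (ev 1 \<gamma>) < e / 2" "dist x0 p \<le> R"
        using that A(2) A1(2) p by auto
      then show ?thesis
        using dist_triangle3[of "ev 0 \<gamma>" "ev 1 \<gamma>" x0] dist_triangle[of x0 "ev 1 \<gamma>" p] \<open>0 < e\<close>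
        unfolding D_def by linarith
    qed
    have AE_dist: "AE \<gamma> in \<pi>. dist (ev 0 \<gamma>) (ev 1 \<gamma>) \<le> D"
      using AE by eventually_elim (auto intro: dist)
    have "AE \<gamma> in \<pi>. \<gamma> \<in> ev t -` ball p e"
      using AE
    proof eventually_elim
      case (elim \<gamma>)
      have "dist (ev t \<gamma>) (ev 1 \<gamma>) = \<bar>t - 1\<bar> * dist (ev 0 \<gamma>) (ev 1 \<gamma>)"
        using elim t by (intro GeoD) auto
      also have "\<dots> \<le> (1 - t) * D"
        using dist[of \<gamma>] elim t by (intro mult_mono) auto
      finally have "dist (ev t \<gamma>) (ev 1 \<gamma>) < e / 2" using tD by simp
      moreover have "dist p (ev 1 \<gamma>) < e / 2" using elim A1(2) by auto
      ultimately show ?case using dist_triangle2[of p "ev t \<gamma>" "ev 1 \<gamma>"] by simp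
    qed
    moreover have "ev t -` ball p e \<in> sets \<pi>"
      using measurable_sets[OF ev_measurable_borel[OF \<pi>D(2), of t], of "ball p e"] t
        sets_eq_imp_space_eq[OF \<pi>D(2)] by simp
    ultimately have "1 = emeasure \<pi> (ev t -` ball p e)"
      by (simp add: \<pi>.emeasure_eq_1_AE)
    also have "\<dots> \<le> ennreal c * emeasure m (ball p e)"
      unfolding c_def
      by (intro OptGeo_emeasure_le[OF Q N monge qcd A'(1) A(3,1) subset_refl unif(3,2) \<pi> AE_dist t]) auto
    finally have "ennreal (1 / c) * 1 \<le> ennreal (1 / c) * (ennreal c * emeasure m (ball p e))"
      by (rule mult_left_mono) simp
    also have "\<dots> = emeasure m (ball p e)"
      using c by (simp add: mult.assoc[symmetric] ennreal_mult'[symmetric])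
    finally show ?thesis by simp
  qed
  then show ?thesis using c by (intro exI[of _ "ennreal (1 / c)"]) auto
qed

text \<open>Balls of radius \<open>e / 2\<close> around \<open>e\<close>-separated points are
  disjoint, each has mass at least \<open>b\<close>, and all lie in one set of finite mass. So
  separated sets have bounded cardinality, and one of maximal cardinality is an
  \<open>e\<close>-net.\<close>

lemma QCD_proper:
  fixes m :: "'a::polish_space measure"
  assumes Q: "1 \<le> Q" and N: "1 < N" and monge: "Monge_space m" and qcd: "QCD Q K N m"
  shows "compact (cball (x0::'a) R)"
  unfolding compact_eq_totally_bounded
proof (intro conjI allI impI)
  show "Topological_Spaces.complete (cball x0 R)" by (simp add: complete_eq_closed)
  fix e :: real assume "0 < e"
  have m: "metric_measure_space m" using monge by (simp add: Monge_space_def)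
  note s [simp] = metric_measure_space_sets[OF m]
  obtain b where b: "0 < b" "\<And>p. p \<in> cball x0 \<bar>R\<bar> \<Longrightarrow> b \<le> emeasure m (ball p (e / 2))"
    using QCD_ball_lower_bound[OF assms, of "\<bar>R\<bar>" "e / 2" x0] \<open>0 < e\<close> by auto
  define sep where "sep S \<longleftrightarrow> finite S \<and> S \<subseteq> cball x0 R \<and> (\<forall>p\<in>S. \<forall>q\<in>S. p \<noteq> q \<longrightarrow> e \<le> dist p q)" for S
  let ?M = "emeasure m (cball x0 (\<bar>R\<bar> + e))"
  have fin: "?M < \<infinity>" using metric_measure_space_finite[OF m] by simp
  have card: "of_nat (card S) * b \<le> ?M" if "sep S" for S
  proof -
    have S: "finite S" "S \<subseteq> cball x0 R" using that by (auto simp: sep_def)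
    have "of_nat (card S) * b = (\<Sum>p\<in>S. b)" by simp
    also have "\<dots> \<le> (\<Sum>p\<in>S. emeasure m (ball p (e / 2)))"
      using S by (intro sum_mono b(2)) auto
    also have "\<dots> = emeasure m (\<Union>p\<in>S. ball p (e / 2))"
    proof (rule sum_emeasure)
      show "disjoint_family_on (\<lambda>p. ball p (e / 2)) S"
        unfolding disjoint_family_on_def
      proof (intro ballI impI)
        fix p q assume "p \<in> S" "q \<in> S" "p \<noteq> q"
        then have "e \<le> dist p q" using that by (auto simp: sep_def)
        then show "ball p (e / 2) \<inter> ball q (e / 2) = {}"
          by (intro disjoint_ballI) auto
      qed
    qed (use S in auto)
    also have "\<dots> \<le> ?M"
    proof (rule emeasure_mono)
      show "(\<Union>p\<in>S. ball p (e / 2)) \<subseteq> cball x0 (\<bar>R\<bar> + e)"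
      proof
        fix y assume "y \<in> (\<Union>p\<in>S. ball p (e / 2))"
        then obtain p where "dist x0 p \<le> R" "dist p y < e / 2" using S by auto
        then show "y \<in> cball x0 (\<bar>R\<bar> + e)"
          using dist_triangle[of x0 y p] \<open>0 < e\<close> by simp
      qed
    qed simp
    finally show ?thesis .
  qed
  have "\<exists>n0::nat. \<forall>S. sep S \<longrightarrow> card S \<le> n0"
  proof -
    \<comment> \<open>\<open>b\<close> is an extended real; the finite mass of a ball at
      \<open>x0\<close> bounds it, so the count becomes a quotient of reals.\<close>
    have "b < \<infinity>" using b(2)[of x0] metric_measure_space_finite[OF m, of "ball x0 (e / 2)"]
      by (auto simp: le_less_trans)
    then obtain r where r: "b = ennreal r" "0 < r" using b(1) by (cases b) auto
    obtain u where u: "?M = ennreal u" "0 \<le> u" using fin by (cases ?M) auto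
    obtain n0 :: nat where n0: "u / r < n0" using reals_Archimedean2 by blast
    have "card S \<le> n0" if "sep S" for S
    proof -
      have "ennreal (card S * r) \<le> ennreal u"
        using card[OF that] r u by (simp add: ennreal_mult ennreal_of_nat_eq_real_of_nat)
      then have "card S * r \<le> u" using u by (simp add: ennreal_le_iff)
      then have "card S \<le> u / r" using r by (simp add: pos_le_divide_eq)
      then show ?thesis using n0 by linarith
    qed
    then show ?thesis by blast
  qed
  then obtain n0 where n0: "\<And>S. sep S \<Longrightarrow> card S < Suc n0" by (auto simp: less_Suc_eq_le)
  have "sep {}" by (simp add: sep_def)
  then obtain S where S: "sep S" "\<And>S'. sep S' \<Longrightarrow> card S' \<le> card S"
    using ex_has_greatest_nat[of sep "{}" card "Suc n0"] n0 by auto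
  have "cball x0 R \<subseteq> (\<Union>p\<in>S. ball p e)"
  proof
    fix q assume q: "q \<in> cball x0 R"
    show "q \<in> (\<Union>p\<in>S. ball p e)"
    proof (rule ccontr)
      assume "q \<notin> (\<Union>p\<in>S. ball p e)"
      then have far: "e \<le> dist p q" if "p \<in> S" for p using that by auto
      then have "sep (insert q S)"
        using S(1) q by (auto simp: sep_def dist_commute)
      from S(2)[OF this] have "q \<in> S" using S(1) by (auto simp: sep_def card_insert_if split: if_splits)
      then show False using far[of q] \<open>0 < e\<close> by simp
    qed
  qed
  then show "\<exists>k. finite k \<and> cball x0 R \<subseteq> (\<Union>x\<in>k. ball x e)"
    using S(1) by (auto simp: sep_def)
qed

section \<open>Almost everywhere uniqueness of geodesics\<close>

lemma Prob2_moment_finite: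
  fixes \<mu> :: "'a::polish_space measure"
  assumes \<mu>: "\<mu> \<in> Prob2"
  shows "(\<integral>\<^sup>+ x. ennreal ((dist x y)\<^sup>2) \<partial>\<mu>) < \<infinity>"
proof -
  have sets [measurable_cong]: "sets \<mu> = sets borel" and P: "prob_space \<mu>"
    using \<mu> by (auto simp: Prob2_def Prob_def)
  interpret prob_space \<mu> by (rule P)
  obtain z where z: "(\<integral>\<^sup>+ x. ennreal ((dist z x)\<^sup>2) \<partial>\<mu>) < \<infinity>"
    using \<mu> by (auto simp: Prob2_def)
  have "(dist x y)\<^sup>2 \<le> 2 * (dist z x)\<^sup>2 + 2 * (dist z y)\<^sup>2" for x
  proof -
    have "(dist x y)\<^sup>2 \<le> (dist z x + dist z y)\<^sup>2"
      by (intro power_mono dist_triangle3) auto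
    also have "\<dots> \<le> 2 * (dist z x)\<^sup>2 + 2 * (dist z y)\<^sup>2"
      using sum_squares_bound[of "dist z x" "dist z y"] by (simp add: power2_sum)
    finally show ?thesis .
  qed
  then have "(\<integral>\<^sup>+ x. ennreal ((dist x y)\<^sup>2) \<partial>\<mu>) \<le>
      (\<integral>\<^sup>+ x. 2 * ennreal ((dist z x)\<^sup>2) + ennreal (2 * (dist z y)\<^sup>2) \<partial>\<mu>)"
    by (intro nn_integral_mono)
      (simp add: ennreal_leI flip: ennreal_plus ennreal_mult' ennreal_numeral)
  also have "\<dots> = 2 * (\<integral>\<^sup>+ x. ennreal ((dist z x)\<^sup>2) \<partial>\<mu>) + ennreal (2 * (dist z y)\<^sup>2)"
    by (simp add: nn_integral_add nn_integral_cmult emeasure_space_1)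
  also have "\<dots> < \<infinity>" using z by (simp add: ennreal_mult_less_top)
  finally show ?thesis .
qed

text \<open>A coupling with a Dirac mass lives on pairs with second entry \<open>y\<close>, so all
  couplings have the same cost and the infimum is taken over a constant. Finiteness of the moment
  keeps \<open>enn2real\<close> in \<open>W2\<close> from losing the value.\<close>

lemma W2_return:
  fixes \<mu> :: "'a::polish_space measure"
  assumes \<mu>: "\<mu> \<in> Prob2"
  shows "ennreal ((W2 \<mu> (return borel y))\<^sup>2) = (\<integral>\<^sup>+ x. ennreal ((dist x y)\<^sup>2) \<partial>\<mu>)" (is "_ = ?I")
proof -
  have sets: "sets \<mu> = sets borel" and P: "prob_space \<mu>"
    using \<mu> by (auto simp: Prob2_def Prob_def)
  interpret prob_space \<mu> by (rule P)
  note [measurable_cong] = sets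
  have cost: "(\<integral>\<^sup>+ z. ennreal ((dist (fst z) (snd z))\<^sup>2) \<partial>q) = ?I" if "q \<in> couplings \<mu> (return borel y)" for q
  proof -
    have q [measurable_cong]: "sets q = sets (borel \<Otimes>\<^sub>M borel)"
      using that unfolding borel_prod by (simp add: couplings_def Prob_def)
    have fst: "distr q borel fst = \<mu>" and snd: "distr q borel snd = return borel y"
      using that by (auto simp: couplings_def)
    have "AE x in distr q borel snd. x = y"
      unfolding snd by (subst AE_return) auto
    then have "AE z in q. snd z = y"
      by (intro AE_distrD[of snd q borel]) auto
    then have "(\<integral>\<^sup>+ z. ennreal ((dist (fst z) (snd z))\<^sup>2) \<partial>q) = (\<integral>\<^sup>+ z. ennreal ((dist (fst z) y)\<^sup>2) \<partial>q)"
      by (intro nn_integral_cong_AE) (auto elim!: eventually_mono)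
    also have "\<dots> = (\<integral>\<^sup>+ x. ennreal ((dist x y)\<^sup>2) \<partial>distr q borel fst)"
      by (subst nn_integral_distr) auto
    finally show ?thesis unfolding fst .
  qed
  let ?q = "distr \<mu> borel (\<lambda>x. (x, y))"
  have [measurable]: "(\<lambda>x. (x, y)) \<in> \<mu> \<rightarrow>\<^sub>M borel"
    unfolding borel_prod[symmetric] by measurable
  have "distr ?q borel fst = distr \<mu> borel (\<lambda>x. x)"
    by (subst distr_distr) (auto simp: comp_def borel_prod[symmetric])
  also have "\<dots> = \<mu>" by (rule distr_id2) (simp add: sets)
  finally have "distr ?q borel fst = \<mu>" .
  moreover have "distr ?q borel snd = return borel y"
    by (subst distr_distr) (auto simp: comp_def borel_prod[symmetric])
  ultimately have "?q \<in> couplings \<mu> (return borel y)"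
    by (simp add: couplings_def Prob_def prob_space_distr)
  then have "(INF q\<in>couplings \<mu> (return borel y).
      \<integral>\<^sup>+ z. ennreal ((dist (fst z) (snd z))\<^sup>2) \<partial>q) = ?I"
    using cost by (intro antisym INF_greatest INF_lower2[of ?q]) auto
  then show ?thesis
    using Prob2_moment_finite[OF \<mu>, of y] by (simp add: W2_def)
qed

lemma OptGeo_return:
  fixes \<mu> :: "'a::polish_space measure"
  assumes \<mu>: "\<mu> \<in> Prob2" and S: "S \<in> borel \<rightarrow>\<^sub>M borel" "\<And>x. S x \<in> geo_between {x} {y}"
  shows "distr \<mu> borel S \<in> OptGeo \<mu> (return borel y)"
proof -
  have sets: "sets \<mu> = sets borel" and P: "prob_space \<mu>"
    using \<mu> by (auto simp: Prob2_def Prob_def)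
  interpret prob_space \<mu> by (rule P)
  have S' [measurable]: "S \<in> \<mu> \<rightarrow>\<^sub>M borel"
    using S(1) measurable_cong_sets[OF sets refl] by blast
  have e [simp]: "ev 0 (S x) = x" "ev 1 (S x) = y" "S x \<in> Geo" for x
    using S(2)[of x] by (auto simp: geo_between_def)
  have AE: "AE \<gamma> in distr \<mu> borel S. \<gamma> \<in> Geo"
    using borel_closed[OF closed_Geo] by (subst AE_distr_iff) auto
  have "distr (distr \<mu> borel S) borel (ev 0) = \<mu>"
    using distr_id2[of borel \<mu>] sets by (subst distr_distr) (auto simp: comp_def)
  moreover have "distr (distr \<mu> borel S) borel (ev 1) = return borel y"
    by (subst distr_distr) (auto simp: comp_def)
  moreover have "kinetic_energy (distr \<mu> borel S) = (\<integral>\<^sup>+ x. ennreal ((dist x y)\<^sup>2) \<partial>\<mu>)"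
  proof -
    have "(\<lambda>\<gamma> :: 'a curve. ennreal ((dist (ev 0 \<gamma>) (ev 1 \<gamma>))\<^sup>2)) \<in> borel_measurable borel"
      by measurable
    then show ?thesis
      unfolding kinetic_energy_Geo[OF AE] by (subst nn_integral_distr) auto
  qed
  ultimately show ?thesis
    using AE W2_return[OF \<mu>, of y] by (simp add: OptGeo_def Prob_def prob_space_distr)
qed

lemma return_Prob2: "return borel (y::'a::polish_space) \<in> Prob2"
proof (rule Prob2_bounded[of _ "{y}"])
  show "return borel y \<in> Prob" by (simp add: Prob_def prob_space_return)
  show "AE x in return borel y. x \<in> {y}" by (subst AE_return) auto
qed simp

text \<open>Otherwise two selections, one in \<open>A1\<close> and one in \<open>A2\<close>, give different optimal plans towards the
  Dirac mass at \<open>y\<close>; every plan on geodesics ending in \<open>y\<close> is optimal.\<close>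

lemma null_two_classes:
  fixes m :: "'a::polish_space measure" and A1 A2 :: "'a curve set"
  assumes proper: "\<And>(x::'a) r. compact (cball x r)" and geodesic: "geodesic_space TYPE('a)"
    and monge: "Monge_space m" and A: "closed A1" "closed A2" "A1 \<inter> A2 = {}"
  shows "AE x in m. geo_between {x} {y} \<inter> A1 = {} \<or> geo_between {x} {y} \<inter> A2 = {}"
proof -
  have m: "metric_measure_space m" using monge by (simp add: Monge_space_def)
  note sets [simp] = metric_measure_space_sets[OF m]
  note space [simp] = metric_measure_space_space[OF m]
  define H where "H A = {x. geo_between {x} {y} \<inter> A \<noteq> {}}" for A :: "'a curve set"
  have "H A = ev 0 ` ((ev 1 -` {y} \<inter> A) \<inter> Geo)" for A
    by (force simp: H_def geo_between_def)
  then have H: "H A \<in> sets borel" if "closed A" for A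
    using that
    by (auto intro!: borel_image_Geo proper closed_Int closed_vimage continuous_on_ev)
  have S: "\<exists>S\<in>borel \<rightarrow>\<^sub>M borel. \<forall>x. S x \<in> geo_between {x} {y} \<and> (x \<in> H A \<longrightarrow> S x \<in> A)"
    if clA: "closed A" for A
  proof -
    obtain G where G: "G \<in> borel_measurable (borel :: ('a \<times> 'a) measure)"
      "\<And>x y. G (x, y) \<in> geo_between {x} {y} \<and> (geo_between {x} {y} \<inter> A \<noteq> {} \<longrightarrow> G (x, y) \<in> A)"
      using geodesic_selection[OF proper geodesic clA] by metis
    have "(\<lambda>x. (x, y)) \<in> borel \<rightarrow>\<^sub>M borel"
      by (intro borel_measurable_continuous_onI continuous_intros)
    from measurable_compose[OF this G(1)] have "(\<lambda>x. G (x, y)) \<in> borel \<rightarrow>\<^sub>M borel" .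
    then show ?thesis using G(2)[of _ y] by (intro bexI[of _ "\<lambda>x. G (x, y)"]) (auto simp: H_def)
  qed
  obtain S1 where S1: "S1 \<in> borel \<rightarrow>\<^sub>M borel" "\<And>x. S1 x \<in> geo_between {x} {y}" "\<And>x. x \<in> H A1 \<Longrightarrow> S1 x \<in> A1"
    using S[OF A(1)] by blast
  obtain S2 where S2: "S2 \<in> borel \<rightarrow>\<^sub>M borel" "\<And>x. S2 x \<in> geo_between {x} {y}" "\<And>x. x \<in> H A2 \<Longrightarrow> S2 x \<in> A2"
    using S[OF A(2)] by blast
  let ?C = "H A1 \<inter> H A2"
  have C: "?C \<in> sets borel" using H A by auto
  \<comment> \<open>Uniqueness of plans is given for probability measures absolutely continuous with
    respect to \<open>m\<close>, so \<open>?C\<close> is tested ball by ball.\<close>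
  have null: "emeasure m (ball z r \<inter> ?C) = 0" if "0 < r" for z :: 'a and r
  proof -
    let ?\<mu> = "uniform_measure m (ball z r)"
    have b: "0 < emeasure m (ball z r)" "emeasure m (ball z r) < \<infinity>"
      using metric_measure_space_ball[OF m that] metric_measure_space_finite[OF m] by auto
    have \<mu>: "?\<mu> \<in> Prob2" by (rule uniform_measure_Prob2[OF m]) (use b in auto)
    have "\<exists>!\<pi>. \<pi> \<in> OptGeo ?\<mu> (return borel y)"
      using monge \<mu> return_Prob2[of y] absolutely_continuous_uniform_measure[of "ball z r" m]
      by (auto simp: Monge_space_def)
    then have eq: "distr ?\<mu> borel S1 = distr ?\<mu> borel S2"
      using OptGeo_return[OF \<mu> S1(1,2)] OptGeo_return[OF \<mu> S2(1,2)] by blast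
    have [measurable]: "S1 \<in> ?\<mu> \<rightarrow>\<^sub>M borel" "S2 \<in> ?\<mu> \<rightarrow>\<^sub>M borel"
      using S1(1) S2(1) by (simp_all cong: measurable_cong_sets)
    \<comment> \<open>The distinguishing event: curves in \<open>A1\<close> that start in
      \<open>?C\<close>. The first selection enters it exactly from \<open>?C\<close>, while the
      second is in \<open>A2\<close> there and never enters it.\<close>
    let ?E = "ev 0 -` ?C \<inter> A1"
    have E: "?E \<in> sets borel"
      using A(1) C measurable_sets_borel[OF measurable_ev'[of 0] C] by (intro sets.Int) auto
    have "emeasure ?\<mu> ?C = emeasure ?\<mu> (S1 -` ?E)"
      using S1(2,3) by (intro arg_cong[of _ _ "emeasure ?\<mu>"]) (force simp: geo_between_def)
    also have "\<dots> = emeasure ?\<mu> (S2 -` ?E)"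
      using arg_cong[OF eq, of "\<lambda>\<pi>. emeasure \<pi> ?E"] E by (simp add: emeasure_distr)
    also have "S2 -` ?E = {}"
      using S2(2,3) A(3) by (force simp: geo_between_def)
    finally have "emeasure m (ball z r \<inter> ?C) / emeasure m (ball z r) = 0"
      using C by (simp add: emeasure_uniform_measure)
    then show ?thesis using b by (auto simp: ennreal_divide_eq_0_iff)
  qed
  obtain z :: 'a where True by blast
  have "?C = (\<Union>n::nat. ball z (Suc n) \<inter> ?C)"
  proof -
    have "\<exists>n::nat. dist z x < Suc n" for x
      using reals_Archimedean2[of "dist z x"] by (metis less_trans lessI of_nat_less_iff)
    then show ?thesis by auto
  qed
  moreover have "(\<Union>n::nat. ball z (Suc n) \<inter> ?C) \<in> null_sets m"
    using C null by (intro null_sets_UN) (auto simp: null_sets_def)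
  ultimately have "?C \<in> null_sets m" by simp
  then show ?thesis
    by (rule AE_I') (auto simp: H_def)
qed

text \<open>The exceptional null set depends on the pair of closed sets, so countably many pairs
  must separate all distinct geodesics. If two are more than \<open>3 / Suc j\<close> apart, a point
  of the dense sequence within \<open>1 / Suc j\<close> of one is at least \<open>2 / Suc j\<close>
  from the other.\<close>

lemma AE_unique_geodesic:
  fixes m :: "'a::polish_space measure" and y :: 'a
  assumes proper: "\<And>(x::'a) r. compact (cball x r)" and geodesic: "geodesic_space TYPE('a)"
    and monge: "Monge_space m"
  shows "AE x in m. \<forall>\<gamma>\<in>geo_between {x} {y}. \<forall>\<eta>\<in>geo_between {x} {y}. \<gamma> = \<eta>"
proof -
  obtain c :: "nat \<Rightarrow> 'a curve" where c: "\<And>\<gamma> e. \<gamma> \<in> Geo \<Longrightarrow> 0 < e \<Longrightarrow> \<exists>k. dist (c k) \<gamma> < e"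
    using Geo_separable[OF proper] by blast
  define near far where "near k j = cball (c k) (1 / Suc j)" and "far k j = {\<eta>. 2 / Suc j \<le> dist (c k) \<eta>}"
    for k j :: nat
  have "AE x in m. \<forall>k j. geo_between {x} {y} \<inter> near k j = {} \<or> geo_between {x} {y} \<inter> far k j = {}"
    unfolding AE_all_countable
  proof (intro allI null_two_classes[OF proper geodesic monge])
    fix k j
    show "closed (near k j)" by (simp add: near_def)
    show "closed (far k j)" unfolding far_def by (intro closed_Collect_le continuous_intros)
    have "(1::real) / Suc j < 2 / Suc j" by (simp add: divide_simps)
    then show "near k j \<inter> far k j = {}" unfolding near_def far_def by auto
  qed
  then show ?thesis
  proof eventually_elim
    case (elim x)
    show ?case
    proof (intro ballI, rule ccontr)
      fix \<gamma> \<eta> assume *: "\<gamma> \<in> geo_between {x} {y}" "\<eta> \<in> geo_between {x} {y}" "\<gamma> \<noteq> \<eta>"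
      then have "0 < dist \<gamma> \<eta> / 3" by simp
      then obtain j where j: "1 / Suc j < dist \<gamma> \<eta> / 3" by (metis nat_approx_posE)
      obtain k where k: "dist (c k) \<gamma> < 1 / Suc j"
        using c[of \<gamma> "1 / Suc j"] * by (auto simp: geo_between_def)
      have "\<gamma> \<in> near k j" using k by (simp add: near_def)
      moreover have "\<eta> \<in> far k j"
        using j k dist_triangle3[of \<gamma> \<eta> "c k"] by (simp add: far_def)
      ultimately show False using elim * by blast
    qed
  qed
qed

section \<open>Compression along geodesics towards a point\<close>

text \<open>The Dirac mass at \<open>y\<close> is approximated by uniform measures on small balls. No weak convergence of
  the optimal plans is needed: \<open>W n\<close> collects the points \<open>x\<close> from which some geodesic into
  \<open>cball y (1 / Suc n)\<close> is at time \<open>t\<close> away from \<open>F\<close>, and if the geodesic from \<open>x\<close> to \<open>y\<close> is unique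
  and in \<open>F\<close> at time \<open>t\<close>, then by compactness \<open>x\<close> leaves \<open>W n\<close> eventually.\<close>

lemma geodesic_contraction_le_compact:
  fixes m :: "'a::polish_space measure"
  assumes Q: "1 \<le> Q" and N: "1 < N" and geodesic: "geodesic_space TYPE('a)"
    and monge: "Monge_space m" and qcd: "QCD Q K N m"
    and A: "A \<in> sets borel" "bounded A" "0 < emeasure m A" and t: "0 < t" "t < 1"
    and h: "h \<in> borel \<rightarrow>\<^sub>M borel" "\<And>x. h x \<in> ev t ` geo_between {x} {y}"
    and D: "\<And>x. x \<in> A \<Longrightarrow> dist x y + 1 \<le> D"
    and F: "compact F" "F \<noteq> {}"
  shows "emeasure (uniform_measure m A) (h -` F) \<le>
    ennreal (Q * (distortion_const K N D / (1 - t)) powr N / measure m A) * emeasure m F"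
    (is "emeasure ?\<mu> _ \<le> ?c * _")
proof -
  have m: "metric_measure_space m" using monge by (simp add: Monge_space_def)
  note sets [simp] = metric_measure_space_sets[OF m]
  note proper = QCD_proper[OF Q N monge qcd]
  obtain z r where "A \<subseteq> cball z r" using A(2) unfolding bounded_subset_cball by blast
  note C = proper[of z r] this
  have \<mu>: "?\<mu> \<in> Prob2" by (rule uniform_measure_Prob2[OF m A])
  interpret \<mu>: prob_space ?\<mu> using \<mu> by (simp add: Prob2_def Prob_def)
  have "closed F" using F(1) by (rule compact_imp_closed)
  have inf_cont: "continuous_on UNIV (\<lambda>\<gamma>. infdist (ev t \<gamma>) F)"
    using t by (intro continuous_intros) auto
  have hF: "h -` F \<in> sets borel"
    using measurable_sets_borel[OF h(1)] \<open>closed F\<close> by auto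
  \<comment> \<open>The margin \<open>1 / Suc k\<close> turns being away from \<open>F\<close> into
    a closed condition on curves, as the compactness argument requires; it is removed at the end,
    when the sets \<open>T k\<close> decrease to \<open>F\<close>.\<close>
  define T where "T k = {x. infdist x F \<le> 1 / Suc k}" for k :: nat
  have T: "closed (T k)" for k
    unfolding T_def by (intro closed_Collect_le continuous_intros)
  have claim: "emeasure ?\<mu> (h -` F) \<le> ?c * emeasure m (T k)" for k
  proof -
    define V where "V n = {\<gamma>. dist y (ev 1 \<gamma>) \<le> 1 / Suc n} \<inter> {\<gamma>. 1 / Suc k \<le> infdist (ev t \<gamma>) F}" for n :: nat
    have V: "closed (V n)" for n
      unfolding V_def by (intro closed_Int closed_Collect_le continuous_intros inf_cont) auto
    have V_anti: "V n \<subseteq> V n'" if "n' \<le> n" for n n'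
    proof -
      have "1 / real (Suc n) \<le> 1 / real (Suc n')" using that by (simp add: divide_simps)
      then show ?thesis by (auto simp: V_def)
    qed
    define W where "W n = ev 0 ` (V n \<inter> Geo)" for n
    have W [measurable]: "W n \<in> sets borel" for n
      unfolding W_def by (intro borel_image_Geo proper V continuous_on_ev) auto
    \<comment> \<open>A geodesic starting off \<open>W n\<close> and ending in the small ball is in
      \<open>T k\<close> at time \<open>t\<close>. Whichever plan is optimal therefore carries this
      mass into \<open>T k\<close>, with bounded density.\<close>
    have le: "emeasure ?\<mu> (- W n) \<le> ?c * emeasure m (T k)" for n
    proof -
      let ?\<nu> = "uniform_measure m (ball y (1 / Suc n))"
      have b: "0 < emeasure m (ball y (1 / Suc n))" by (rule metric_measure_space_ball[OF m]) simp
      have \<nu>: "?\<nu> \<in> Prob2" "?\<nu> \<in> Prob_c_ac m"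
        using b by (auto intro!: uniform_measure_Prob2[OF m]
            uniform_measure_Prob_c_ac[OF m _ _ proper[of y "1 / Suc n"]])
      obtain \<pi> where \<pi>: "\<pi> \<in> OptGeo ?\<mu> ?\<nu>"
        using monge \<mu> \<nu> absolutely_continuous_uniform_measure[of A m] A(1)
        unfolding Monge_space_def by (metis sets)
      note \<pi>D = OptGeo_D[OF \<pi>]
      note ev = ev_measurable_borel[OF \<pi>D(2)]
      have [simp]: "space \<pi> = UNIV" using sets_eq_imp_space_eq[OF \<pi>D(2)] by simp
      have AE: "AE \<gamma> in \<pi>. \<gamma> \<in> Geo \<and> ev 0 \<gamma> \<in> A \<and> ev 1 \<gamma> \<in> ball y (1 / Suc n)"
        using A by (intro OptGeo_AE_ends[OF \<pi>] AE_uniform_measure_mem) auto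
      \<comment> \<open>The \<open>+ 1\<close> in the assumption on \<open>D\<close> absorbs the
        radius of the target ball.\<close>
      have AE_dist: "AE \<gamma> in \<pi>. dist (ev 0 \<gamma>) (ev 1 \<gamma>) \<le> D"
        using AE
      proof eventually_elim
        case (elim \<gamma>)
        have "1 / real (Suc n) \<le> 1" by simp
        then have "dist y (ev 1 \<gamma>) \<le> 1" using elim unfolding mem_ball by linarith
        then show ?case
          using D[of "ev 0 \<gamma>"] elim dist_triangle[of "ev 0 \<gamma>" "ev 1 \<gamma>" y] by linarith
      qed
      have "emeasure ?\<mu> (- W n) = emeasure (distr \<pi> borel (ev 0)) (- W n)"
        by (simp only: \<pi>D(4))
      also have "\<dots> = emeasure \<pi> (ev 0 -` (- W n))"
        by (subst emeasure_distr[OF ev]) auto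
      also have "\<dots> \<le> emeasure \<pi> (ev t -` T k)"
      proof (rule emeasure_mono_AE)
        show "ev t -` T k \<in> sets \<pi>"
          using measurable_sets[OF ev[of t], of "T k"] t T by auto
        show "AE \<gamma> in \<pi>. \<gamma> \<in> ev 0 -` (- W n) \<longrightarrow> \<gamma> \<in> ev t -` T k"
          using AE
        proof eventually_elim
          case (elim \<gamma>)
          have "\<gamma> \<in> V n" if "ev t \<gamma> \<notin> T k" using that elim by (simp add: V_def T_def)
          then show ?case using elim by (auto simp: W_def)
        qed
      qed
      also have "\<dots> \<le> ?c * emeasure m (T k)"
        using T
        by (intro OptGeo_emeasure_le[OF Q N monge qcd A(1,3) C \<nu>(2,1) \<pi> AE_dist t]) auto
      finally show ?thesis .
    qed
    have "AE x in m. x \<notin> h -` F \<inter> (\<Inter>n. W n)"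
      using AE_unique_geodesic[OF proper geodesic monge, of y]
    proof eventually_elim
      case (elim x)
      show ?case
      proof
        assume x: "x \<in> h -` F \<inter> (\<Inter>n. W n)"
        let ?S = "geo_between {x} (cball y 1)"
        have "?S \<inter> (\<Inter>n. V n) \<noteq> {}"
        proof (rule compact_imp_fip_image)
          show "compact ?S" by (intro compact_geo_between proper) auto
          fix I :: "nat set" assume "finite I" "I \<subseteq> UNIV"
          then obtain n where "\<forall>i\<in>I. i \<le> n" by (meson finite_nat_set_iff_bounded_le)
          then have "V n \<subseteq> (\<Inter>i\<in>I. V i)" using V_anti by blast
          moreover have "x \<in> W n" using x by auto
          then obtain \<gamma> where "\<gamma> \<in> V n" "\<gamma> \<in> Geo" "x = ev 0 \<gamma>" by (auto simp: W_def)
          moreover then have "dist y (ev 1 \<gamma>) \<le> 1"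
            by (auto simp: V_def intro: order_trans)
          ultimately show "?S \<inter> (\<Inter>i\<in>I. V i) \<noteq> {}" by (auto simp: geo_between_def)
        qed (rule V)
        then obtain \<gamma> where \<gamma>: "\<gamma> \<in> Geo" "ev 0 \<gamma> = x" "\<And>n. \<gamma> \<in> V n"
          by (auto simp: geo_between_def)
        have "dist y (ev 1 \<gamma>) \<le> 0"
        proof (rule field_le_epsilon)
          fix e :: real assume "0 < e"
          then obtain n where "1 / Suc n < e" by (metis nat_approx_posE)
          moreover have "dist y (ev 1 \<gamma>) \<le> 1 / Suc n" using \<gamma>(3)[of n] by (simp add: V_def)
          ultimately show "dist y (ev 1 \<gamma>) \<le> 0 + e" by simp
        qed
        then have "\<gamma> \<in> geo_between {x} {y}" using \<gamma> by (auto simp: geo_between_def)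
        then have "h x = ev t \<gamma>" using h(2)[of x] elim by auto
        moreover have "0 < 1 / real (Suc k)" by simp
        moreover have "1 / Suc k \<le> infdist (ev t \<gamma>) F" using \<gamma>(3)[of 0] by (simp add: V_def)
        ultimately show False using x F(2) by simp
      qed
    qed
    moreover have meas: "h -` F \<inter> (\<Inter>n. W n) \<in> sets borel" using hF by auto
    ultimately have "h -` F \<inter> (\<Inter>n. W n) \<in> null_sets m"
      using metric_measure_space_space[OF m] by (subst AE_iff_null_sets) auto
    then have "h -` F \<inter> (\<Inter>n. W n) \<in> null_sets ?\<mu>"
      using absolutely_continuous_uniform_measure[of A m] A(1)
      by (auto simp: absolutely_continuous_def)
    then have zero: "emeasure ?\<mu> (\<Inter>n. h -` F \<inter> W n) = 0"
      by (auto simp: null_sets_def)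
    have "decseq (\<lambda>n. h -` F \<inter> W n)"
      using V_anti by (force simp: decseq_def W_def)
    then have "(\<lambda>n. emeasure ?\<mu> (h -` F \<inter> W n)) \<longlonglongrightarrow> emeasure ?\<mu> (\<Inter>n. h -` F \<inter> W n)"
      using hF by (intro Lim_emeasure_decseq) auto
    then have "(\<lambda>n. emeasure ?\<mu> (h -` F \<inter> W n)) \<longlonglongrightarrow> 0" unfolding zero .
    then have "(\<lambda>n. ?c * emeasure m (T k) + emeasure ?\<mu> (h -` F \<inter> W n)) \<longlonglongrightarrow> ?c * emeasure m (T k) + 0"
      by (intro tendsto_add tendsto_const)
    moreover have "emeasure ?\<mu> (h -` F) \<le> ?c * emeasure m (T k) + emeasure ?\<mu> (h -` F \<inter> W n)" for n
    proof -
      have "emeasure ?\<mu> (h -` F) \<le> emeasure ?\<mu> (- W n \<union> h -` F \<inter> W n)"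
        using hF by (intro emeasure_mono) auto
      also have "\<dots> \<le> emeasure ?\<mu> (- W n) + emeasure ?\<mu> (h -` F \<inter> W n)"
        using hF by (intro emeasure_subadditive) auto
      also have "\<dots> \<le> ?c * emeasure m (T k) + emeasure ?\<mu> (h -` F \<inter> W n)"
        by (intro add_right_mono le)
      finally show ?thesis .
    qed
    ultimately show ?thesis by (intro LIMSEQ_le_const[where X = "\<lambda>n. _ n"]) auto
  qed
  have "decseq T"
  proof (rule decseq_SucI)
    fix k
    have "1 / real (Suc (Suc k)) \<le> 1 / real (Suc k)" by (simp add: divide_simps)
    then show "T (Suc k) \<subseteq> T k" by (auto simp: T_def)
  qed
  have "bounded F" using F(1) by (rule compact_imp_bounded)
  then obtain z r where zr: "F \<subseteq> cball z r" unfolding bounded_subset_cball by blast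
  have "T k \<subseteq> cball z (r + 2)" for k
  proof
    fix x assume "x \<in> T k"
    moreover have "1 / real (Suc k) \<le> 1" by simp
    ultimately have "infdist x F < 2" unfolding T_def mem_Collect_eq by linarith
    moreover have "2 \<le> infdist x F" if "\<And>a. a \<in> F \<Longrightarrow> 2 \<le> dist x a"
      unfolding infdist_notempty[OF F(2)] using that F(2) by (intro cINF_greatest) auto
    ultimately obtain a where "a \<in> F" "dist x a < 2" by (meson not_le)
    moreover then have "dist z a \<le> r" using zr by auto
    ultimately show "x \<in> cball z (r + 2)"
      using dist_triangle2[of z x a] by simp
  qed
  then have "emeasure m (T k) < \<infinity>" for k
    using T by (intro metric_measure_space_finite[OF m]) (auto intro: bounded_subset[OF bounded_cball])
  then have "(\<lambda>k. emeasure m (T k)) \<longlonglongrightarrow> emeasure m (\<Inter>k. T k)"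
    using T \<open>decseq T\<close> by (intro Lim_emeasure_decseq) (auto simp: less_top)
  also have "(\<Inter>k. T k) = F"
  proof (intro equalityI subsetI)
    fix x assume x: "x \<in> (\<Inter>k. T k)"
    have "infdist x F \<le> 0"
    proof (rule field_le_epsilon)
      fix e :: real assume "0 < e"
      then obtain n where "1 / Suc n < e" by (metis nat_approx_posE)
      moreover have "infdist x F \<le> 1 / Suc n" using x by (auto simp: T_def)
      ultimately show "infdist x F \<le> 0 + e" by simp
    qed
    then show "x \<in> F"
      using in_closed_iff_infdist_zero[OF \<open>closed F\<close> F(2)] infdist_nonneg[of x F] by (metis antisym)
  qed (auto simp: T_def)
  finally have "(\<lambda>k. ?c * emeasure m (T k)) \<longlonglongrightarrow> ?c * emeasure m F"
    by (intro ennreal_tendsto_cmult) auto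
  then show ?thesis
    by (rule LIMSEQ_le_const) (use claim in auto)
qed

text \<open>The 2 bounds \<open>1 / (1 - t)\<close> for \<open>t \<le> 1 / 2\<close>, which makes
  the constant independent of time.\<close>

definition contraction_const :: "real \<Rightarrow> real \<Rightarrow> real \<Rightarrow> real \<Rightarrow> real" where
  "contraction_const Q K N D = Q * (2 * distortion_const K N D) powr N"

lemma contraction_const_ge_1:
  assumes "1 \<le> Q" "1 < N"
  shows "1 \<le> contraction_const Q K N D"
proof -
  have "1 \<le> (2 * distortion_const K N D) powr N"
    using distortion_const_ge_1[of K N D] assms by (intro ge_one_powr_ge_zero) auto
  then have "1 * 1 \<le> Q * (2 * distortion_const K N D) powr N"
    using assms by (intro mult_mono) auto
  then show ?thesis by (simp add: contraction_const_def)
qed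

text \<open>Inner regularity of the image measure passes from compact to Borel sets. Time 0 is
  separate because the curvature condition covers interior times only; there \<open>h\<close> is the
  identity.\<close>

lemma geodesic_contraction_le:
  fixes m :: "'a::polish_space measure"
  assumes Q: "1 \<le> Q" and N: "1 < N" and geodesic: "geodesic_space TYPE('a)"
    and monge: "Monge_space m" and qcd: "QCD Q K N m"
    and A: "A \<in> sets borel" "bounded A" "0 < emeasure m A" and t: "0 \<le> t" "t \<le> 1 / 2"
    and h: "h \<in> borel \<rightarrow>\<^sub>M borel" "\<And>x. h x \<in> ev t ` geo_between {x} {y}"
    and D: "\<And>x. x \<in> A \<Longrightarrow> dist x y + 1 \<le> D" and B: "B \<in> sets borel"
  shows "emeasure (uniform_measure m A) (h -` B) \<le>
    ennreal (contraction_const Q K N D / measure m A) * emeasure m B"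
    (is "emeasure ?\<mu> _ \<le> ?c * _")
proof -
  have m: "metric_measure_space m" using monge by (simp add: Monge_space_def)
  note sets [simp] = metric_measure_space_sets[OF m]
  note fin = metric_measure_space_finite[OF m A(1,2)]
  have mA: "0 < measure m A" using A(3) fin by (simp add: measure_def enn2real_positive_iff)
  show ?thesis
  proof (cases "t = 0")
    case True
    have "h x = x" for x using h(2)[of x] True by (auto simp: geo_between_def)
    then have "h -` B = B" by auto
    then have "emeasure ?\<mu> (h -` B) = emeasure ?\<mu> B" by (rule arg_cong)
    also have "\<dots> = emeasure m (A \<inter> B) / emeasure m A"
      using A(1) B by (simp add: emeasure_uniform_measure)
    also have "\<dots> = ennreal (1 / measure m A) * emeasure m (A \<inter> B)"
      using fin mA by (simp add: emeasure_eq_ennreal_measure divide_ennreal_def inverse_ennreal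
          inverse_eq_divide mult.commute)
    also have "\<dots> \<le> ?c * emeasure m B"
      using A(1) B contraction_const_ge_1[OF Q N, of K D]
      by (intro mult_mono ennreal_leI divide_right_mono emeasure_mono) auto
    finally show ?thesis .
  next
    case False
    then have t': "0 < t" "t < 1" using t by auto
    have \<mu>: "?\<mu> \<in> Prob2" by (rule uniform_measure_Prob2[OF m A])
    interpret \<mu>: prob_space ?\<mu> using \<mu> by (simp add: Prob2_def Prob_def)
    have h': "h \<in> ?\<mu> \<rightarrow>\<^sub>M borel" using h(1) by (simp cong: measurable_cong_sets)
    interpret \<nu>: prob_space "distr ?\<mu> borel h" by (rule \<mu>.prob_space_distr[OF h'])
    note space [simp] = metric_measure_space_space[OF m]
    have dc: "1 \<le> distortion_const K N D" by (rule distortion_const_ge_1)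
    have "distortion_const K N D / (1 - t) \<le> 2 * distortion_const K N D"
    proof -
      have "distortion_const K N D * 1 \<le> distortion_const K N D * (2 * (1 - t))"
        using dc t by (intro mult_left_mono) auto
      then show ?thesis using t' by (simp add: pos_divide_le_eq algebra_simps)
    qed
    then have const: "ennreal (Q * (distortion_const K N D / (1 - t)) powr N / measure m A) \<le> ?c"
      unfolding contraction_const_def using Q N dc t' mA
      by (intro ennreal_leI divide_right_mono mult_left_mono powr_mono2) auto
    \<comment> \<open>The empty set is split off because \<open>infdist\<close> to it is 0 by
      convention, so the neighbourhoods of \<open>F\<close> would not shrink to
      \<open>F\<close>.\<close>
    have comp: "emeasure (distr ?\<mu> borel h) F \<le> ?c * emeasure m B" if F: "compact F" "F \<subseteq> B" for F
    proof (cases "F = {}")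
      case False
      have "F \<in> sets borel" using F(1) by (simp add: compact_imp_closed)
      then have "emeasure (distr ?\<mu> borel h) F = emeasure ?\<mu> (h -` F)"
        by (simp add: emeasure_distr[OF h'])
      also have "\<dots> \<le> ennreal (Q * (distortion_const K N D / (1 - t)) powr N / measure m A) * emeasure m F"
        by (rule geodesic_contraction_le_compact[OF Q N geodesic monge qcd A t' h D F(1) False])
      also have "\<dots> \<le> ?c * emeasure m B"
        using B F(2) const by (intro mult_mono emeasure_mono) auto
      finally show ?thesis .
    qed simp
    have "emeasure ?\<mu> (h -` B) = emeasure (distr ?\<mu> borel h) B"
      using B by (simp add: emeasure_distr[OF h'])
    also have "\<dots> = (SUP F\<in>{F. F \<subseteq> B \<and> compact F}. emeasure (distr ?\<mu> borel h) F)"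
      using B \<nu>.emeasure_space_1 by (intro inner_regular) auto
    also have "\<dots> \<le> ?c * emeasure m B"
      using comp by (intro SUP_least) auto
    finally show ?thesis .
  qed
qed

section \<open>Plans from the independent coupling\<close>

text \<open>For \<open>t \<le> 1 / 2\<close> freeze the endpoint \<open>y\<close>, for \<open>t \<ge> 1 / 2\<close> freeze the starting point \<open>x\<close> and reverse
  time; either way the moving endpoint stays at parameter distance at least \<open>1 / 2\<close> from the frozen
  one, where the contraction bound would degenerate.\<close>

lemma independent_plan_emeasure_le:
  fixes m :: "'a::polish_space measure" and G :: "'a \<times> 'a \<Rightarrow> 'a curve"
  assumes Q: "1 \<le> Q" and N: "1 < N" and geodesic: "geodesic_space TYPE('a)"
    and monge: "Monge_space m" and qcd: "QCD Q K N m"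
    and G: "G \<in> borel \<rightarrow>\<^sub>M borel" "\<And>x y. G (x, y) \<in> geo_between {x} {y}"
    and A: "A \<in> sets borel" "bounded A" "0 < emeasure m A"
    and A': "A' \<in> sets borel" "bounded A'" "0 < emeasure m A'"
    and D: "\<And>x y. x \<in> A \<Longrightarrow> y \<in> A' \<Longrightarrow> dist x y + 1 \<le> D"
    and t: "t \<in> {0..1}" and B: "B \<in> sets borel"
  shows "emeasure (uniform_measure m A \<Otimes>\<^sub>M uniform_measure m A') ((\<lambda>p. ev t (G p)) -` B) \<le>
    ennreal (max (contraction_const Q K N D / measure m A) (contraction_const Q K N D / measure m A'))
      * emeasure m B"
proof -
  have m: "metric_measure_space m" using monge by (simp add: Monge_space_def)
  note sets [simp, measurable_cong] = metric_measure_space_sets[OF m]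
  note space [simp] = metric_measure_space_space[OF m]
  let ?\<mu> = "uniform_measure m A" and ?\<mu>' = "uniform_measure m A'"
  interpret \<mu>: prob_space ?\<mu>
    using uniform_measure_Prob2[OF m A] by (simp add: Prob2_def Prob_def)
  interpret \<mu>': prob_space ?\<mu>'
    using uniform_measure_Prob2[OF m A'] by (simp add: Prob2_def Prob_def)
  interpret pair_prob_space ?\<mu> ?\<mu>' ..
  let ?h = "\<lambda>p. ev t (G p)"
  have h: "?h \<in> borel \<rightarrow>\<^sub>M borel"
    by (rule measurable_ev[OF t G(1)])
  have sl: "(\<lambda>x. ?h (x, y)) \<in> borel \<rightarrow>\<^sub>M borel" "(\<lambda>x. ?h (y, x)) \<in> borel \<rightarrow>\<^sub>M borel" for y
    by (intro measurable_compose[OF _ h] borel_measurable_continuous_onI continuous_intros)+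
  have hB: "?h -` B \<in> sets (?\<mu> \<Otimes>\<^sub>M ?\<mu>')"
  proof -
    have "sets (?\<mu> \<Otimes>\<^sub>M ?\<mu>') = sets (borel \<Otimes>\<^sub>M borel :: ('a \<times> 'a) measure)"
      by (intro sets_pair_measure_cong) auto
    also have "\<dots> = sets borel" by (simp only: borel_prod)
    finally show ?thesis using measurable_sets_borel[OF h B] by simp
  qed
  let ?c = "contraction_const Q K N D / measure m A" and ?c' = "contraction_const Q K N D / measure m A'"
  show ?thesis
  proof (cases "t \<le> 1 / 2")
    case True
    have "emeasure (?\<mu> \<Otimes>\<^sub>M ?\<mu>') (?h -` B) = (\<integral>\<^sup>+ y. emeasure ?\<mu> ((\<lambda>x. (x, y)) -` (?h -` B)) \<partial>?\<mu>')"
      by (rule emeasure_pair_measure_alt2[OF hB])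
    also have "\<dots> \<le> (\<integral>\<^sup>+ y. ennreal ?c * emeasure m B \<partial>?\<mu>')"
    proof (rule nn_integral_mono_AE)
      have "AE y in ?\<mu>'. y \<in> A'" using A' by (intro AE_uniform_measure_mem) simp
      then show "AE y in ?\<mu>'. emeasure ?\<mu> ((\<lambda>x. (x, y)) -` (?h -` B)) \<le> ennreal ?c * emeasure m B"
      proof eventually_elim
        case (elim y)
        have "emeasure ?\<mu> ((\<lambda>x. ?h (x, y)) -` B) \<le> ennreal ?c * emeasure m B"
          using t True D[OF _ elim] G(2)
          by (intro geodesic_contraction_le[OF Q N geodesic monge qcd A _ _ sl(1) _ _ B]) auto
        then show ?case by (simp add: vimage_def)
      qed
    qed
    also have "\<dots> = ennreal ?c * emeasure m B" using \<mu>'.emeasure_space_1 by simp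
    also have "\<dots> \<le> ennreal (max ?c ?c') * emeasure m B"
      by (intro mult_right_mono ennreal_leI) auto
    finally show ?thesis .
  next
    case False
    have "emeasure (?\<mu> \<Otimes>\<^sub>M ?\<mu>') (?h -` B) = (\<integral>\<^sup>+ x. emeasure ?\<mu>' (Pair x -` (?h -` B)) \<partial>?\<mu>)"
      by (rule \<mu>'.emeasure_pair_measure_alt[OF hB])
    also have "\<dots> \<le> (\<integral>\<^sup>+ x. ennreal ?c' * emeasure m B \<partial>?\<mu>)"
    proof (rule nn_integral_mono_AE)
      have "AE x in ?\<mu>. x \<in> A" using A by (intro AE_uniform_measure_mem) simp
      then show "AE x in ?\<mu>. emeasure ?\<mu>' (Pair x -` (?h -` B)) \<le> ennreal ?c' * emeasure m B"
      proof eventually_elim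
        case (elim x)
        \<comment> \<open>The contraction bound looks only at positions: it suffices that this point
          lies at time \<open>1 - t\<close> on some geodesic from \<open>y\<close> to
          \<open>x\<close>, without any symmetry of \<open>G\<close>.\<close>
        have "?h (x, y) \<in> ev (1 - t) ` geo_between {y} {x}" for y
        proof -
          have g: "G (x, y) \<in> Geo" "ev 0 (G (x, y)) = x" "ev 1 (G (x, y)) = y"
            using G(2)[of x y] by (auto simp: geo_between_def)
          obtain \<eta> where \<eta>: "\<eta> \<in> Geo" "\<And>s. s \<in> {0..1} \<Longrightarrow> ev s \<eta> = ev (1 - s) (G (x, y))"
            using Geo_reverse[OF g(1)] by blast
          have "\<eta> \<in> geo_between {y} {x}"
            using \<eta> g by (auto simp: geo_between_def)
          moreover have "ev (1 - t) \<eta> = ?h (x, y)" using \<eta>(2)[of "1 - t"] t by auto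
          ultimately show ?thesis by (metis image_eqI)
        qed
        then have "emeasure ?\<mu>' ((\<lambda>y. ?h (x, y)) -` B) \<le> ennreal ?c' * emeasure m B"
          using t False D[OF elim]
          by (intro geodesic_contraction_le[OF Q N geodesic monge qcd A' _ _ sl(2) _ _ B, where t = "1 - t"])
            (auto simp: dist_commute)
        then show ?case by (simp add: vimage_def)
      qed
    qed
    also have "\<dots> = ennreal ?c' * emeasure m B" using \<mu>.emeasure_space_1 by simp
    also have "\<dots> \<le> ennreal (max ?c ?c') * emeasure m B"
      by (intro mult_right_mono ennreal_leI) auto
    finally show ?thesis .
  qed
qed

section \<open>Borel dependence of the product plans on the radii\<close>

lemma distr_pair_snd:
  assumes "prob_space M" "sigma_finite_measure N"
  shows "distr (M \<Otimes>\<^sub>M N) N snd = N"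
proof (rule measure_eqI)
  interpret M: prob_space M by fact
  interpret N: sigma_finite_measure N by fact
  fix A assume "A \<in> sets (distr (M \<Otimes>\<^sub>M N) N snd)"
  then have A: "A \<in> sets N" by simp
  then have "emeasure (distr (M \<Otimes>\<^sub>M N) N snd) A = emeasure (M \<Otimes>\<^sub>M N) (space M \<times> A)"
    by (auto simp: emeasure_distr space_pair_measure dest: sets.sets_into_space
        intro!: arg_cong2[where f = emeasure])
  also have "\<dots> = emeasure N A"
    using A by (simp add: N.emeasure_pair_measure_Times M.emeasure_space_1)
  finally show "emeasure (distr (M \<Otimes>\<^sub>M N) N snd) A = emeasure N A" .
qed simp

text \<open>Monotonicity in the radius gives measurability even if spheres carry mass.\<close>

lemma borel_measurable_ball_measure:
  fixes m :: "'a::polish_space measure"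
  assumes m: "metric_measure_space m"
  shows "(\<lambda>e. measure m (ball x e)) \<in> borel_measurable borel"
proof (rule borel_measurable_mono, rule monoI)
  fix r s :: real assume "r \<le> s"
  then show "measure m (ball x r) \<le> measure m (ball x s)"
    using metric_measure_space_finite[OF m, of "ball x s"] metric_measure_space_sets[OF m]
    by (intro measure_mono_fmeasurable) (auto simp: fmeasurable_def)
qed

text \<open>Both uniform measures are densities with respect to the fixed measure \<open>m\<close>,
  so the radii enter only through the integrand and the integral is measurable in the
  parameters.\<close>

lemma borel_measurable_integral_independent:
  fixes m :: "'a::polish_space measure" and f :: "'a \<times> 'a \<Rightarrow> real"
  assumes m: "metric_measure_space m" and f: "f \<in> borel_measurable borel"
  shows "(\<lambda>(e0, e1). \<integral>p. f p \<partial>(uniform_measure m (ball x0 e0) \<Otimes>\<^sub>M uniform_measure m (ball x1 e1)))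
    \<in> borel_measurable (restrict_space borel ({0<..\<epsilon>} \<times> {0<..\<epsilon>}))"
proof -
  note sets [simp, measurable_cong] = metric_measure_space_sets[OF m]
  interpret m: sigma_finite_measure m by (rule metric_measure_space_sigma_finite[OF m])
  interpret pair_sigma_finite m m ..
  have f' [measurable]: "f \<in> borel_measurable (borel \<Otimes>\<^sub>M borel)"
    using f unfolding borel_prod .
  note [measurable] = borel_measurable_ball_measure[OF m]
  define w where "w x e z = indicator (ball x e) z / measure m (ball x e)" for x z :: 'a and e
  \<comment> \<open>Written as a comparison, the indicator of the varying ball is visibly measurable
    jointly in radius and point.\<close>
  have w_eq: "w x e z = (if dist x z < e then 1 else 0) / measure m (ball x e)" for x z e
    by (simp add: w_def indicator_def)
  define g where "g = (\<lambda>e :: real \<times> real. \<integral>p. w x0 (fst e) (fst p) * w x1 (snd e) (snd p) * f p \<partial>(m \<Otimes>\<^sub>M m))"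
  have "g \<in> borel_measurable (borel \<Otimes>\<^sub>M borel)"
    unfolding g_def w_eq
  proof (rule borel_measurable_lebesgue_integral)
    show "(\<lambda>(e :: real \<times> real, p).
        (if dist x0 (fst p) < fst e then 1 else 0) / measure m (ball x0 (fst e)) *
        ((if dist x1 (snd p) < snd e then 1 else 0) / measure m (ball x1 (snd e))) * f p)
      \<in> borel_measurable ((borel \<Otimes>\<^sub>M borel) \<Otimes>\<^sub>M (m \<Otimes>\<^sub>M m))"
      by measurable
  qed
  then have g: "g \<in> borel_measurable (restrict_space borel ({0<..\<epsilon>} \<times> {0<..\<epsilon>}))"
    unfolding borel_prod by (rule measurable_restrict_space1)
  show ?thesis
  proof (subst measurable_cong[OF _])
    fix e :: "real \<times> real" assume "e \<in> space (restrict_space borel ({0<..\<epsilon>} \<times> {0<..\<epsilon>}))"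
    then obtain e0 e1 where e: "e = (e0, e1)" "0 < e0" "0 < e1"
      by (cases e) (auto simp: space_restrict_space)
    have dens: "uniform_measure m (ball x r) = density m (\<lambda>z. ennreal (w x r z))" if "0 < r" for x r
    proof -
      have "0 < emeasure m (ball x r)" "emeasure m (ball x r) < \<infinity>"
        using metric_measure_space_ball[OF m that] metric_measure_space_finite[OF m] by auto
      then have pos: "0 < measure m (ball x r)" and eq: "emeasure m (ball x r) = ennreal (measure m (ball x r))"
        by (auto simp: measure_def enn2real_positive_iff)
      show ?thesis
        unfolding uniform_measure_def w_def eq using pos
        by (intro arg_cong[of _ _ "density m"] ext) (simp add: divide_ennreal split: split_indicator flip: ennreal_1)
    qed
    have w [measurable]: "w x r \<in> borel_measurable borel" "w x r \<in> borel_measurable m" for x r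
      unfolding w_eq[abs_def] by measurable
    have w_nonneg: "0 \<le> w x r z" for x r z by (simp add: w_def)
    interpret u1: prob_space "density m (\<lambda>z. ennreal (w x1 e1 z))"
      unfolding dens[OF e(3), symmetric]
      using uniform_measure_Prob2[OF m, of "ball x1 e1"] metric_measure_space_ball[OF m e(3)]
      by (simp add: Prob2_def Prob_def)
    have "uniform_measure m (ball x0 e0) \<Otimes>\<^sub>M uniform_measure m (ball x1 e1) =
        density (m \<Otimes>\<^sub>M m) (\<lambda>(x, y). ennreal (w x0 e0 x) * ennreal (w x1 e1 y))"
      unfolding dens[OF e(2)] dens[OF e(3)]
      by (rule pair_measure_density) (auto simp: m.sigma_finite_measure_axioms u1.sigma_finite_measure_axioms)
    also have "\<dots> = density (m \<Otimes>\<^sub>M m) (\<lambda>p. ennreal (w x0 e0 (fst p) * w x1 e1 (snd p)))"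
      by (intro arg_cong[of _ _ "density (m \<Otimes>\<^sub>M m)"] ext) (auto simp: ennreal_mult w_nonneg)
    finally have pair_eq: "uniform_measure m (ball x0 e0) \<Otimes>\<^sub>M uniform_measure m (ball x1 e1) =
        density (m \<Otimes>\<^sub>M m) (\<lambda>p. ennreal (w x0 e0 (fst p) * w x1 e1 (snd p)))" .
    have "(\<integral>p. f p \<partial>(uniform_measure m (ball x0 e0) \<Otimes>\<^sub>M uniform_measure m (ball x1 e1))) =
        (\<integral>p. (w x0 e0 (fst p) * w x1 e1 (snd p)) *\<^sub>R f p \<partial>(m \<Otimes>\<^sub>M m))"
      unfolding pair_eq
      by (rule integral_density; ((rule AE_I2, intro mult_nonneg_nonneg w_nonneg) | measurable))
    then show "(case e of (e0, e1) \<Rightarrow> \<integral>p. f p \<partial>(uniform_measure m (ball x0 e0) \<Otimes>\<^sub>M uniform_measure m (ball x1 e1))) = g e"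
      by (simp add: e g_def)
  qed (rule g)
qed

theorem theorem3p6:
  fixes m :: "'a::polish_space measure" and Q K N :: real
  assumes "Q \<ge> 1" and "N > 1"
    and "geodesic_space TYPE('a)"
    and "Monge_space m"
    and "QCD Q K N m"
  shows "measured_length_space m"
proof -
  have m: "metric_measure_space m" using assms(4) by (simp add: Monge_space_def)
  note sets [simp, measurable_cong] = metric_measure_space_sets[OF m]
  note space [simp] = metric_measure_space_space[OF m]
  note proper = QCD_proper[OF assms(1,2,4,5)]
  obtain G :: "'a \<times> 'a \<Rightarrow> 'a curve" where G: "G \<in> borel \<rightarrow>\<^sub>M borel" "\<And>x y. G (x, y) \<in> geo_between {x} {y}"
    using geodesic_selection[OF proper assms(3), of UNIV] by auto
  have G_simps [simp]: "G p \<in> Geo" "ev 0 (G p) = fst p" "ev 1 (G p) = snd p" for p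
    using G(2)[of "fst p" "snd p"] by (auto simp: geo_between_def)
  define U where "U x e = uniform_measure m (ball x e)" for x :: 'a and e
  have sets_U [simp, measurable_cong]: "sets (U x e) = sets borel" for x e by (simp add: U_def)
  have sets_P: "sets (U x0 e0 \<Otimes>\<^sub>M U x1 e1) = sets borel" for x0 x1 e0 e1
  proof -
    have "sets (U x0 e0 \<Otimes>\<^sub>M U x1 e1) = sets (borel \<Otimes>\<^sub>M borel :: ('a \<times> 'a) measure)"
      by (intro sets_pair_measure_cong) auto
    then show ?thesis by (simp only: borel_prod)
  qed
  have space_P [simp]: "space (U x0 e0 \<Otimes>\<^sub>M U x1 e1) = UNIV" for x0 x1 e0 e1
    using sets_eq_imp_space_eq[OF sets_P] by simp
  have G_meas: "G \<in> (U x0 e0 \<Otimes>\<^sub>M U x1 e1) \<rightarrow>\<^sub>M borel" for x0 x1 e0 e1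
    using G(1) measurable_cong_sets[OF sets_P refl] by blast
  have U_prob: "prob_space (U x e)" if "0 < e" for x e
    using uniform_measure_Prob2[OF m, of "ball x e"] metric_measure_space_ball[OF m that]
    by (simp add: U_def Prob2_def Prob_def)
  define \<pi> where "\<pi> x0 x1 e0 e1 = distr (U x0 e0 \<Otimes>\<^sub>M U x1 e1) borel G" for x0 x1 e0 e1
  have P_prob: "prob_space (U x0 e0 \<Otimes>\<^sub>M U x1 e1)" if "0 < e0" "0 < e1" for x0 x1 e0 e1
  proof -
    interpret a: prob_space "U x0 e0" by (rule U_prob[OF that(1)])
    interpret b: prob_space "U x1 e1" by (rule U_prob[OF that(2)])
    interpret pair_prob_space "U x0 e0" "U x1 e1" ..
    show ?thesis by unfold_locales
  qed
  have \<pi>_Prob: "\<pi> x0 x1 e0 e1 \<in> Prob" if "0 < e0" "0 < e1" for x0 x1 e0 e1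
    using prob_space.prob_space_distr[OF P_prob[OF that] G_meas] by (simp add: \<pi>_def Prob_def)
  have \<pi>_Geo: "AE \<gamma> in \<pi> x0 x1 e0 e1. \<gamma> \<in> Geo" for x0 x1 e0 e1
    unfolding \<pi>_def using borel_closed[OF closed_Geo] by (subst AE_distr_iff[OF G_meas]) auto
  have \<pi>_ev: "distr (\<pi> x0 x1 e0 e1) borel (ev t) = distr (U x0 e0 \<Otimes>\<^sub>M U x1 e1) borel (\<lambda>p. ev t (G p))"
    if "t \<in> {0..1}" for x0 x1 e0 e1 t
    unfolding \<pi>_def by (subst distr_distr[OF measurable_ev'[OF that] G_meas]) (simp add: comp_def)
  have marg0: "distr (\<pi> x0 x1 e0 e1) borel (ev 0) = U x0 e0" if "0 < e0" "0 < e1" for x0 x1 e0 e1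
  proof -
    interpret b: prob_space "U x1 e1" by (rule U_prob[OF that(2)])
    have "distr (\<pi> x0 x1 e0 e1) borel (ev 0) = distr (U x0 e0 \<Otimes>\<^sub>M U x1 e1) (U x0 e0) fst"
      by (subst \<pi>_ev) (auto intro!: distr_cong)
    then show ?thesis by (simp add: b.distr_pair_fst)
  qed
  have marg1: "distr (\<pi> x0 x1 e0 e1) borel (ev 1) = U x1 e1" if "0 < e0" "0 < e1" for x0 x1 e0 e1
  proof -
    interpret b: prob_space "U x1 e1" by (rule U_prob[OF that(2)])
    have "distr (\<pi> x0 x1 e0 e1) borel (ev 1) = distr (U x0 e0 \<Otimes>\<^sub>M U x1 e1) (U x1 e1) snd"
      by (subst \<pi>_ev) (auto intro!: distr_cong)
    then show ?thesis
      by (simp add: distr_pair_snd[OF U_prob[OF that(1)] b.sigma_finite_measure_axioms])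
  qed
  have AE_U: "AE x in U x0 e. dist x0 x < e" for x0 e
    using AE_uniform_measure_mem[of "ball x0 e" m] unfolding U_def by simp
  have energy: "kinetic_energy (\<pi> x0 x1 e0 e1) \<le> ennreal ((dist x0 x1 + e0 + e1)\<^sup>2)"
    if "0 < e0" "0 < e1" for x0 x1 e0 e1
  proof -
    interpret \<pi>: prob_space "\<pi> x0 x1 e0 e1" using \<pi>_Prob[OF that] by (simp add: Prob_def)
    have sets_\<pi>: "sets (\<pi> x0 x1 e0 e1) = sets borel" by (simp add: \<pi>_def)
    have "AE \<gamma> in \<pi> x0 x1 e0 e1. dist x0 (ev 0 \<gamma>) < e0"
      using AE_U[of x0 e0] unfolding marg0[OF that, symmetric, of x0 x1]
      by (intro AE_distrD[OF ev_measurable_borel[OF sets_\<pi>]]) auto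
    moreover have "AE \<gamma> in \<pi> x0 x1 e0 e1. dist x1 (ev 1 \<gamma>) < e1"
      using AE_U[of x1 e1] unfolding marg1[OF that, symmetric, of x1 x0]
      by (intro AE_distrD[OF ev_measurable_borel[OF sets_\<pi>]]) auto
    ultimately have "AE \<gamma> in \<pi> x0 x1 e0 e1.
        ennreal ((dist (ev 0 \<gamma>) (ev 1 \<gamma>))\<^sup>2) \<le> ennreal ((dist x0 x1 + e0 + e1)\<^sup>2)"
    proof eventually_elim
      case (elim \<gamma>)
      have "dist (ev 0 \<gamma>) (ev 1 \<gamma>) \<le> dist x0 x1 + e0 + e1"
        using dist_triangle3[of "ev 0 \<gamma>" "ev 1 \<gamma>" x0] dist_triangle[of x0 "ev 1 \<gamma>" x1] elim by linarith
      then show ?case by (intro ennreal_leI power_mono) auto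
    qed
    then have "kinetic_energy (\<pi> x0 x1 e0 e1) \<le> (\<integral>\<^sup>+ \<gamma>. ennreal ((dist x0 x1 + e0 + e1)\<^sup>2) \<partial>\<pi> x0 x1 e0 e1)"
      unfolding kinetic_energy_Geo[OF \<pi>_Geo] by (rule nn_integral_mono_AE)
    then show ?thesis using \<pi>.emeasure_space_1 by simp
  qed
  have plan: "test_plan m (\<pi> x0 x1 e0 e1)" if e: "0 < e0" "0 < e1" for x0 x1 e0 e1
  proof -
    define D where "D = dist x0 x1 + e0 + e1 + 1"
    let ?c = "\<lambda>x e. contraction_const Q K N D / measure m (ball x e)"
    have b: "0 < emeasure m (ball x e)" if "0 < e" for x e by (rule metric_measure_space_ball[OF m that])
    have "0 < measure m (ball x0 e0)"
      using b[OF e(1)] metric_measure_space_finite[OF m, of "ball x0 e0"]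
      by (simp add: measure_def enn2real_positive_iff)
    then have pos: "0 < max (?c x0 e0) (?c x1 e1)"
      using contraction_const_ge_1[OF assms(1,2), of K D] by (intro less_max_iff_disj[THEN iffD2] disjI1) auto
    have "emeasure (distr (\<pi> x0 x1 e0 e1) borel (ev t)) B \<le> ennreal (max (?c x0 e0) (?c x1 e1)) * emeasure m B"
      if t: "t \<in> {0..1}" and B: "B \<in> sets borel" for t B
    proof -
      have "emeasure (distr (\<pi> x0 x1 e0 e1) borel (ev t)) B =
          emeasure (U x0 e0 \<Otimes>\<^sub>M U x1 e1) ((\<lambda>p. ev t (G p)) -` B)"
        unfolding \<pi>_ev[OF t] using B by (subst emeasure_distr[OF measurable_ev[OF t G_meas]]) auto
      also have "\<dots> \<le> ennreal (max (?c x0 e0) (?c x1 e1)) * emeasure m B"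
        unfolding U_def
      proof (rule independent_plan_emeasure_le[OF assms(1-5) G _ _ b[OF e(1)] _ _ b[OF e(2)] _ t B])
        fix x y assume "x \<in> ball x0 e0" "y \<in> ball x1 e1"
        then show "dist x y + 1 \<le> D"
          using dist_triangle3[of x y x0] dist_triangle[of x0 y x1] by (simp add: D_def)
      qed auto
      finally show ?thesis .
    qed
    moreover have "AE \<gamma> in \<pi> x0 x1 e0 e1. \<gamma> \<in> AC2"
      using \<pi>_Geo by eventually_elim (use Geo_subset_AC2 in auto)
    ultimately show ?thesis
      unfolding test_plan_def using \<pi>_Prob[OF e] pos le_less_trans[OF energy[OF e, of x0 x1]]
      by (auto intro!: exI[of _ "max (?c x0 e0) (?c x1 e1)"])
  qed
  have meas: "(\<lambda>(e0, e1). \<integral>\<gamma>. \<phi> \<gamma> \<partial>\<pi> x0 x1 e0 e1)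
      \<in> borel_measurable (restrict_space borel ({0<..\<epsilon>} \<times> {0<..\<epsilon>}))"
    if "continuous_on UNIV \<phi>" for \<phi> :: "'a curve \<Rightarrow> real" and x0 x1 \<epsilon>
  proof -
    have \<phi>: "\<phi> \<in> borel_measurable borel" by (rule borel_measurable_continuous_onI[OF that])
    have "(\<integral>\<gamma>. \<phi> \<gamma> \<partial>\<pi> x0 x1 e0 e1) = (\<integral>p. \<phi> (G p) \<partial>(U x0 e0 \<Otimes>\<^sub>M U x1 e1))" for e0 e1
      unfolding \<pi>_def by (rule integral_distr[OF G_meas \<phi>])
    then show ?thesis
      using borel_measurable_integral_independent[OF m measurable_compose[OF G(1) \<phi>], of x0 x1 \<epsilon>]
      by (simp add: U_def)
  qed
  have limsup: "Limsup (at_right 0 \<times>\<^sub>F at_right 0) (\<lambda>(e0, e1). kinetic_energy (\<pi> x0 x1 e0 e1))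
      \<le> ennreal ((dist x0 x1)\<^sup>2)" for x0 x1
  proof -
    let ?F = "at_right (0::real) \<times>\<^sub>F at_right (0::real)"
    have "eventually (\<lambda>e::real. 0 < e) (at_right 0)" by (rule eventually_at_right_less)
    from eventually_prodI[OF this this]
    have "\<forall>\<^sub>F e in ?F. (case e of (e0, e1) \<Rightarrow> kinetic_energy (\<pi> x0 x1 e0 e1)) \<le>
        ennreal ((dist x0 x1 + fst e + snd e)\<^sup>2)"
      by eventually_elim (auto simp: energy)
    then have "Limsup ?F (\<lambda>(e0, e1). kinetic_energy (\<pi> x0 x1 e0 e1)) \<le>
        Limsup ?F (\<lambda>e. ennreal ((dist x0 x1 + fst e + snd e)\<^sup>2))"
      by (rule Limsup_mono)
    also have "\<dots> = ennreal ((dist x0 x1)\<^sup>2)"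
    proof (rule lim_imp_Limsup)
      show "\<not> trivial_limit ?F" by (simp add: prod_filter_eq_bot trivial_limit_at_right_real)
      have "(fst \<longlongrightarrow> 0) ?F" "(snd \<longlongrightarrow> 0) ?F"
        by (rule filterlim_mono[OF filterlim_fst at_within_le_nhds order_refl])
          (rule filterlim_mono[OF filterlim_snd at_within_le_nhds order_refl])
      then have "((\<lambda>e. ennreal ((dist x0 x1 + fst e + snd e)\<^sup>2)) \<longlongrightarrow> ennreal ((dist x0 x1 + 0 + 0)\<^sup>2)) ?F"
        by (intro tendsto_ennrealI tendsto_intros)
      then show "((\<lambda>e. ennreal ((dist x0 x1 + fst e + snd e)\<^sup>2)) \<longlongrightarrow> ennreal ((dist x0 x1)\<^sup>2)) ?F" by simp
    qed
    finally show ?thesis .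
  qed
  \<comment> \<open>The construction works at all points and for all radii, so
    \<open>\<Omega>\<close> is the whole space and the value 1 for \<open>\<epsilon>\<close> is
    arbitrary.\<close>
  show ?thesis
    unfolding measured_length_space_def
  proof (intro conjI exI[of _ UNIV] ballI)
    fix x0 x1 :: 'a
    show "\<exists>\<epsilon>>0. \<exists>\<pi> :: real \<Rightarrow> real \<Rightarrow> 'a curve measure.
          (\<forall>\<epsilon>0\<in>{0<..\<epsilon>}. \<forall>\<epsilon>1\<in>{0<..\<epsilon>}.
             test_plan m (\<pi> \<epsilon>0 \<epsilon>1) \<and>
             distr (\<pi> \<epsilon>0 \<epsilon>1) borel (ev 0) = uniform_measure m (ball x0 \<epsilon>0) \<and>
             distr (\<pi> \<epsilon>0 \<epsilon>1) borel (ev 1) = uniform_measure m (ball x1 \<epsilon>1)) \<and>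
          (\<forall>\<phi> :: 'a curve \<Rightarrow> real. continuous_on UNIV \<phi> \<and> bounded (range \<phi>) \<longrightarrow>
             (\<lambda>(\<epsilon>0, \<epsilon>1). \<integral>\<gamma>. \<phi> \<gamma> \<partial>\<pi> \<epsilon>0 \<epsilon>1)
               \<in> borel_measurable (restrict_space borel ({0<..\<epsilon>} \<times> {0<..\<epsilon>}))) \<and>
          Limsup (at_right 0 \<times>\<^sub>F at_right 0) (\<lambda>(\<epsilon>0, \<epsilon>1). kinetic_energy (\<pi> \<epsilon>0 \<epsilon>1))
            \<le> ennreal ((dist x0 x1)\<^sup>2)"
      using plan marg0 marg1 meas limsup
      by (intro exI[of _ 1] conjI exI[of _ "\<pi> x0 x1"]) (auto simp: U_def)
  qed (use m in auto)
qed

end
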